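(* Let $(A,[\![\cdot,\cdot]\!],\rho,\Omega)$ be a symplectic-like Lie algebroid over $M$ and $\Phi:G\times A\to A$ a Hamiltonian action of a connected Lie group $G$ on $A$ with equivariant momentum map $J:M\to\mathfrak g^*$ and associated Lie algebra anti-morphism $\psi:\mathfrak g\to\Gamma(A)$. Suppose that $\mu\in\mathfrak g^*$ is a regular value of $J$ such that $T_xJ\circ\rho_x:A_x\to T_\mu\mathfrak g^*$ has constant rank for all $x\in J^{-1}(\mu)$, and that the restricted action of $G_\mu$ on $J^{-1}(\mu)$ is free and proper. Let $\{\cdot,\cdot\}$ be the Poisson bracket on $M$ induced by $\Omega$ and $\{\cdot,\cdot\}_\mu$ the Poisson bracket on $J^{-1}(\mu)/G_\mu$ induced by the reduced symplectic-like Lie algebroid $(A_\mu,\Omega_\mu)$. Then $$\{\tilde f,\tilde g\}_\mu\circ\pi_\mu=\{f,g\}\circ i_\mu$$ for all $\tilde f,\tilde g\in C^\infty(J^{-1}(\mu)/G_\mu)$, where $i_\mu:J^{-1}(\mu)\to M$ is the canonical inclusion, $\pi_\mu:J^{-1}(\mu)\to J^{-1}(\mu)/G_\mu$ is the canonical projection, and $f,g\in C^\infty(M)$ are arbitrary $G$-invariant extensions of $\tilde f\circ\pi_\mu$ and $\tilde g\circ\pi_\mu$, respectively.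
   Context: Let $(A,[\![\cdot,\cdot]\!],\rho)$ be a Lie algebroid over $M$ with projection $\tau:A\to M$, differential $d^A$, and $\mathcal L^A_X=i_Xd^A+d^Ai_X$. For a vector bundle morphism $F:A\to A'$ over $f$, $(F^*\alpha')_x(a_1,\dots,a_k)=\alpha'_{f(x)}(F(a_1),\dots,F(a_k))$; $F$ is a Lie algebroid morphism if $d^AF^*=F^*d^{A'}$. The complete lift of $X\in\Gamma(A)$ is the unique vector field $X^c$ on $A$, $\tau$-projectable onto $\rho(X)$, with $X^c(\widehat\alpha)=\widehat{\mathcal L^A_X\alpha}$ for $\alpha\in\Gamma(A^* )$ ($\widehat\beta$ is the linear function on $A$ defined by $\beta\in\Gamma(A^* )$). A Lie algebroid is symplectic-like if it carries a nondegenerate $\Omega\in\Gamma(\wedge^2A^* )$ with $d^A\Omega=0$. For $f\in C^\infty(M)$ the Hamiltonian section $\mathcal H^\Omega_f\in\Gamma(A)$ is defined by $i_{\mathcal H^\Omega_f}\Omega=d^Af$, and the base $M$ is a Poisson manifold with bracket $\{f,g\}=\rho(\mathcal H^\Omega_g)(f)$. A left action $\Phi:G\times A\to A$ of a Lie group by vector bundle automorphisms covering $\phi:G\times M\to M$ is by complete lifts with respect to a Lie algebra anti-morphism $\psi:\mathfrak g\to\Gamma(A)$ if the infinitesimal generator of each $\xi\in\mathfrak g$ with respect to $\Phi$ is $(\psi(\xi))^c$. Such an action is Hamiltonian with equivariant momentum map the smooth map $J:M\to\mathfrak g^*$ if $J(\phi_g(x))=Coad^G_g(J(x))$ ($Coad^G$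 is the left coadjoint action), $\Phi_g^*\Omega=\Omega$, and $i_{\psi(\xi)}\Omega=d^AJ_\xi$ for all $g\in G$, $\xi\in\mathfrak g$, where $J_\xi(x)=J(x)(\xi)$. Define $J^T:A\to\mathfrak g^*\times\mathfrak g^*$ by $J^T(a)=(TJ(\rho(a)),J(\tau(a)))$. Under the hypotheses on $\mu$, $(J^T)^{-1}(0,\mu)$ is a Lie subalgebroid of $A$ over $J^{-1}(\mu)$. Let $G_\mu$ be the coadjoint isotropy group of $\mu$, with Lie algebra $\mathfrak g_\mu$. The group $TG_\mu\cong G_\mu\times\mathfrak g_\mu$ (left trivialization, product $(g,\xi)(g',\xi')=(gg',\xi'+Ad_{(g')^{-1}}\xi)$) acts on $(J^T)^{-1}(0,\mu)$ by $((g,\xi),a_x)\mapsto\Phi_g(a_x+\psi(\xi)(x))$. The reduced symplectic-like Lie algebroid is $A_\mu=(J^T)^{-1}(0,\mu)/TG_\mu\to J^{-1}(\mu)/G_\mu$, with the Lie algebroid structure making the projection $\widetilde\pi_\mu:(J^T)^{-1}(0,\mu)\to A_\mu$ a Lie algebroid epimorphism over $\pi_\mu$, and with the symplectic-like section $\Omega_\mu$ characterized by $\widetilde\pi_\mu^*\Omega_\mu=\widetilde\iota_\mu^*\Omega$, $\widetilde\iota_\mu:(J^T)^{-1}(0,\mu)\to A$ being the inclusion. *)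

theory Defs
  imports "HOL-Analysis.Analysis" "HOL-Algebra.Group" "HOL-Library.Function_Algebras"
begin

section \<open>Smooth manifolds\<close>

text \<open>
  \<open>\<real>\<^sup>n\<close> is \<^const>\<open>Euclidean_space\<close> \<open>n\<close>, i.e. the sequences vanishing from index \<open>n\<close> on, so that
  all dimensions (including 0) live in one type. \<open>diff_class n U k f\<close> says that \<open>f\<close> is of
  class \<open>C\<^sup>k\<close> on the open set \<open>U\<close>: all partial derivatives up to order \<open>k\<close> exist and are
  continuous on \<open>U\<close>.
\<close>

definition partial_deriv :: "nat \<Rightarrow> ((nat \<Rightarrow> real) \<Rightarrow> real) \<Rightarrow> (nat \<Rightarrow> real) \<Rightarrow> real" where
  "partial_deriv i f x = deriv (\<lambda>t. f (x(i := t))) (x i)"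

primrec diff_class :: "nat \<Rightarrow> (nat \<Rightarrow> real) set \<Rightarrow> nat \<Rightarrow> ((nat \<Rightarrow> real) \<Rightarrow> real) \<Rightarrow> bool" where
  "diff_class n U 0 f \<longleftrightarrow>
     continuous_map (subtopology (Euclidean_space n) U) euclideanreal f"
| "diff_class n U (Suc k) f \<longleftrightarrow>
     continuous_map (subtopology (Euclidean_space n) U) euclideanreal f \<and>
     (\<forall>i<n. (\<forall>x\<in>U. (\<lambda>t. f (x(i := t))) differentiable at (x i)) \<and>
            diff_class n U k (partial_deriv i f))"

definition smooth_on_Rn :: "nat \<Rightarrow> (nat \<Rightarrow> real) set \<Rightarrow> ((nat \<Rightarrow> real) \<Rightarrow> real) \<Rightarrow> bool" where
  "smooth_on_Rn n U f \<longleftrightarrow> (\<forall>k. diff_class n U k f)"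

text \<open>
  A manifold is given by its dimension and an atlas (not required to be maximal) of charts
  \<open>(U, \<phi>)\<close>; the underlying set is the union of the chart domains, and the topology is the one
  for which the charts are homeomorphisms onto open subsets of \<open>\<real>\<^sup>n\<close>.
\<close>

type_synonym 'm chart = "'m set \<times> ('m \<Rightarrow> nat \<Rightarrow> real)"

record 'm mfd =
  mdim :: nat
  charts :: "'m chart set"

definition pts :: "'m mfd \<Rightarrow> 'm set" where
  "pts M = (\<Union>(U, \<phi>)\<in>charts M. U)"

definition mtop :: "'m mfd \<Rightarrow> 'm topology" where
  "mtop M = topology (\<lambda>W. W \<subseteq> pts M \<and>
     (\<forall>(U, \<phi>)\<in>charts M. openin (Euclidean_space (mdim M)) (\<phi> ` (U \<inter> W))))"

definition is_chart :: "nat \<Rightarrow> 'm chart \<Rightarrow> bool" where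
  "is_chart n c \<longleftrightarrow> (case c of (U, \<phi>) \<Rightarrow>
     inj_on \<phi> U \<and> openin (Euclidean_space n) (\<phi> ` U))"

definition smooth_transition :: "nat \<Rightarrow> 'm chart \<Rightarrow> 'm chart \<Rightarrow> bool" where
  "smooth_transition n c d \<longleftrightarrow> (case c of (U, \<phi>) \<Rightarrow> case d of (V, \<psi>) \<Rightarrow>
     openin (Euclidean_space n) (\<phi> ` (U \<inter> V)) \<and>
     (\<forall>i<n. smooth_on_Rn n (\<phi> ` (U \<inter> V)) (\<lambda>y. \<psi> (inv_into U \<phi> y) i)))"

definition smooth_manifold :: "'m mfd \<Rightarrow> bool" where
  "smooth_manifold M \<longleftrightarrow>
     (\<forall>c\<in>charts M. is_chart (mdim M) c) \<and>
     (\<forall>c\<in>charts M. \<forall>d\<in>charts M. smooth_transition (mdim M) c d) \<and>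
     Hausdorff_space (mtop M) \<and> second_countable (mtop M)"

text \<open>\<open>f\<close> is smooth on some neighbourhood of \<open>x\<close>.\<close>

definition smooth_at :: "'m mfd \<Rightarrow> 'm \<Rightarrow> ('m \<Rightarrow> real) \<Rightarrow> bool" where
  "smooth_at M x f \<longleftrightarrow> (\<exists>(U, \<phi>)\<in>charts M. x \<in> U \<and>
     (\<exists>W. openin (Euclidean_space (mdim M)) W \<and> \<phi> x \<in> W \<and> W \<subseteq> \<phi> ` U \<and>
          smooth_on_Rn (mdim M) W (f \<circ> inv_into U \<phi>)))"

text \<open>Values outside \<open>pts M\<close> are irrelevant.\<close>

definition Cinf :: "'m mfd \<Rightarrow> ('m \<Rightarrow> real) set" where
  "Cinf M = {f. \<forall>x\<in>pts M. smooth_at M x f}"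

definition smooth_map :: "'m mfd \<Rightarrow> 'n mfd \<Rightarrow> ('m \<Rightarrow> 'n) \<Rightarrow> bool" where
  "smooth_map M N F \<longleftrightarrow> F ` pts M \<subseteq> pts N \<and> continuous_map (mtop M) (mtop N) F \<and>
     (\<forall>x\<in>pts M. \<forall>(V, \<psi>)\<in>charts N. F x \<in> V \<longrightarrow>
        (\<forall>i<mdim N. smooth_at M x (\<lambda>y. \<psi> (F y) i)))"

definition diffeomorphism :: "'m mfd \<Rightarrow> 'n mfd \<Rightarrow> ('m \<Rightarrow> 'n) \<Rightarrow> bool" where
  "diffeomorphism M N F \<longleftrightarrow> bij_betw F (pts M) (pts N) \<and> smooth_map M N F \<and>
     smooth_map N M (inv_into (pts M) F)"

definition Rn :: "nat \<Rightarrow> (nat \<Rightarrow> real) mfd" where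
  "Rn n = \<lparr>mdim = n, charts = {(topspace (Euclidean_space n), id)}\<rparr>"

definition open_submanifold :: "'m mfd \<Rightarrow> 'm set \<Rightarrow> 'm mfd" where
  "open_submanifold M W = \<lparr>mdim = mdim M, charts = {(U \<inter> W, \<phi>) | U \<phi>. (U, \<phi>) \<in> charts M}\<rparr>"

definition prod_mfd :: "'m mfd \<Rightarrow> 'n mfd \<Rightarrow> ('m \<times> 'n) mfd" where
  "prod_mfd M N = \<lparr>mdim = mdim M + mdim N,
     charts = {(U \<times> V, \<lambda>(x, y) i. if i < mdim M then \<phi> x i else \<psi> y (i - mdim M))
               | U \<phi> V \<psi>. (U, \<phi>) \<in> charts M \<and> (V, \<psi>) \<in> charts N}\<rparr>"


section \<open>Tangent vectors\<close>

text \<open>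
  Tangent vectors at \<open>x\<close> are derivations of germs at \<open>x\<close>, represented as functionals on all
  functions that are \<open>0\<close> on the functions not smooth near \<open>x\<close>. The base point
  is not recorded in the functional.
\<close>

type_synonym 'm tvec = "('m \<Rightarrow> real) \<Rightarrow> real"

definition tangent_space :: "'m mfd \<Rightarrow> 'm \<Rightarrow> 'm tvec set" where
  "tangent_space M x = {D. x \<in> pts M \<and>
     (\<forall>f. \<not> smooth_at M x f \<longrightarrow> D f = 0) \<and>
     (\<forall>f g. smooth_at M x f \<longrightarrow> smooth_at M x g \<longrightarrow>
        (\<exists>W. openin (mtop M) W \<and> x \<in> W \<and> (\<forall>y\<in>W. f y = g y)) \<longrightarrow> D f = D g) \<and>
     (\<forall>f g. smooth_at M x f \<longrightarrow> smooth_at M x g \<longrightarrow> D (\<lambda>y. f y + g y) = D f + D g) \<and>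
     (\<forall>c f. smooth_at M x f \<longrightarrow> D (\<lambda>y. c * f y) = c * D f) \<and>
     (\<forall>f g. smooth_at M x f \<longrightarrow> smooth_at M x g \<longrightarrow>
        D (\<lambda>y. f y * g y) = D f * g x + f x * D g)}"

definition tangent_map :: "'m mfd \<Rightarrow> 'n mfd \<Rightarrow> ('m \<Rightarrow> 'n) \<Rightarrow> 'm \<Rightarrow> 'm tvec \<Rightarrow> 'n tvec" where
  "tangent_map M N F x D = (\<lambda>h. if smooth_at N (F x) h then D (h \<circ> F) else 0)"

definition tangent_bundle :: "'m mfd \<Rightarrow> ('m \<times> 'm tvec) mfd" where
  "tangent_bundle M = \<lparr>mdim = 2 * mdim M,
     charts = {({(x, D). x \<in> U \<and> D \<in> tangent_space M x},
                \<lambda>(x, D) i. if i < mdim M then \<phi> x i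
                           else if i < 2 * mdim M then D (\<lambda>y. \<phi> y (i - mdim M)) else 0)
               | U \<phi>. (U, \<phi>) \<in> charts M}\<rparr>"

definition vector_field :: "'m mfd \<Rightarrow> ('m \<Rightarrow> 'm tvec) \<Rightarrow> bool" where
  "vector_field M Z \<longleftrightarrow> smooth_map M (tangent_bundle M) (\<lambda>x. (x, Z x))"

definition vf_bracket ::
  "'m mfd \<Rightarrow> ('m \<Rightarrow> 'm tvec) \<Rightarrow> ('m \<Rightarrow> 'm tvec) \<Rightarrow> 'm \<Rightarrow> 'm tvec" where
  "vf_bracket M Y Z x =
     (\<lambda>h. if smooth_at M x h then Y x (\<lambda>y. Z y h) - Z x (\<lambda>y. Y y h) else 0)"

definition submersion :: "'m mfd \<Rightarrow> 'n mfd \<Rightarrow> ('m \<Rightarrow> 'n) \<Rightarrow> bool" where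
  "submersion M N F \<longleftrightarrow> smooth_map M N F \<and>
     (\<forall>x\<in>pts M. tangent_map M N F x ` tangent_space M x = tangent_space N (F x))"

text \<open>\<open>N\<close> is a manifold structure on a subset of \<open>M\<close> whose inclusion is an embedding.\<close>

definition embedded_submanifold :: "'m mfd \<Rightarrow> 'm mfd \<Rightarrow> bool" where
  "embedded_submanifold M N \<longleftrightarrow> smooth_manifold N \<and> pts N \<subseteq> pts M \<and>
     mtop N = subtopology (mtop M) (pts N) \<and> smooth_map N M (\<lambda>x. x) \<and>
     (\<forall>x\<in>pts N. inj_on (tangent_map N M (\<lambda>x. x) x) (tangent_space N x))"


section \<open>Lie groups\<close>

record 'g lie_group = "'g monoid" +
  gmfd :: "'g mfd"

definition is_lie_group :: "'g lie_group \<Rightarrow> bool" where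
  "is_lie_group G \<longleftrightarrow> group G \<and> smooth_manifold (gmfd G) \<and> pts (gmfd G) = carrier G \<and>
     smooth_map (prod_mfd (gmfd G) (gmfd G)) (gmfd G) (\<lambda>(g, h). g \<otimes>\<^bsub>G\<^esub> h) \<and>
     smooth_map (gmfd G) (gmfd G) (\<lambda>g. inv\<^bsub>G\<^esub> g)"

text \<open>The Lie algebra is \<open>T\<^sub>eG\<close> with the bracket of left-invariant vector fields.\<close>

definition lie_alg :: "'g lie_group \<Rightarrow> 'g tvec set" where
  "lie_alg G = tangent_space (gmfd G) \<one>\<^bsub>G\<^esub>"

definition left_inv_field :: "'g lie_group \<Rightarrow> 'g tvec \<Rightarrow> 'g \<Rightarrow> 'g tvec" where
  "left_inv_field G \<xi> g = tangent_map (gmfd G) (gmfd G) (\<lambda>k. g \<otimes>\<^bsub>G\<^esub> k) \<one>\<^bsub>G\<^esub> \<xi>"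

definition lie_alg_bracket :: "'g lie_group \<Rightarrow> 'g tvec \<Rightarrow> 'g tvec \<Rightarrow> 'g tvec" where
  "lie_alg_bracket G \<xi> \<eta> =
     vf_bracket (gmfd G) (left_inv_field G \<xi>) (left_inv_field G \<eta>) \<one>\<^bsub>G\<^esub>"

definition Ad :: "'g lie_group \<Rightarrow> 'g \<Rightarrow> 'g tvec \<Rightarrow> 'g tvec" where
  "Ad G g \<xi> = tangent_map (gmfd G) (gmfd G) (\<lambda>k. g \<otimes>\<^bsub>G\<^esub> k \<otimes>\<^bsub>G\<^esub> inv\<^bsub>G\<^esub> g) \<one>\<^bsub>G\<^esub> \<xi>"

text \<open>Elements of \<open>\<gg>\<^sup>*\<close> are extended by \<open>0\<close> outside \<open>\<gg>\<close>.\<close>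

definition lie_dual :: "'g lie_group \<Rightarrow> ('g tvec \<Rightarrow> real) set" where
  "lie_dual G = {\<mu>. (\<forall>\<xi>. \<xi> \<notin> lie_alg G \<longrightarrow> \<mu> \<xi> = 0) \<and>
     (\<forall>\<xi>\<in>lie_alg G. \<forall>\<eta>\<in>lie_alg G. \<mu> (\<lambda>h. \<xi> h + \<eta> h) = \<mu> \<xi> + \<mu> \<eta>) \<and>
     (\<forall>c. \<forall>\<xi>\<in>lie_alg G. \<mu> (\<lambda>h. c * \<xi> h) = c * \<mu> \<xi>)}"

definition Coad :: "'g lie_group \<Rightarrow> 'g \<Rightarrow> ('g tvec \<Rightarrow> real) \<Rightarrow> 'g tvec \<Rightarrow> real" where
  "Coad G g \<mu> = (\<lambda>\<xi>. if \<xi> \<in> lie_alg G then \<mu> (Ad G (inv\<^bsub>G\<^esub> g) \<xi>) else 0)"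

definition isotropy :: "'g lie_group \<Rightarrow> ('g tvec \<Rightarrow> real) \<Rightarrow> 'g set" where
  "isotropy G \<mu> = {g \<in> carrier G. Coad G g \<mu> = \<mu>}"

text \<open>
  The isotropy group, being closed, has a unique structure of embedded submanifold; its Lie
  algebra is the tangent space at the identity, regarded as a subspace of \<open>\<gg>\<close>.
\<close>

definition isotropy_alg :: "'g lie_group \<Rightarrow> ('g tvec \<Rightarrow> real) \<Rightarrow> 'g tvec set" where
  "isotropy_alg G \<mu> = {\<xi>. \<exists>S. embedded_submanifold (gmfd G) S \<and> pts S = isotropy G \<mu> \<and>
     \<xi> \<in> tangent_map S (gmfd G) (\<lambda>g. g) \<one>\<^bsub>G\<^esub> ` tangent_space S \<one>\<^bsub>G\<^esub>}"

definition smooth_left_action :: "'g lie_group \<Rightarrow> 'm mfd \<Rightarrow> ('g \<Rightarrow> 'm \<Rightarrow> 'm) \<Rightarrow> bool" where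
  "smooth_left_action G M \<phi> \<longleftrightarrow> smooth_map (prod_mfd (gmfd G) M) M (\<lambda>(g, x). \<phi> g x) \<and>
     (\<forall>x\<in>pts M. \<phi> \<one>\<^bsub>G\<^esub> x = x) \<and>
     (\<forall>g\<in>carrier G. \<forall>h\<in>carrier G. \<forall>x\<in>pts M. \<phi> (g \<otimes>\<^bsub>G\<^esub> h) x = \<phi> g (\<phi> h x))"

text \<open>The generator \<open>x \<mapsto> d/dt \<phi>(exp(t\<xi>), x)\<close> at \<open>t = 0\<close>, i.e. \<open>\<xi>\<close> pushed forward by the orbit map.\<close>

definition inf_generator ::
  "'g lie_group \<Rightarrow> 'm mfd \<Rightarrow> ('g \<Rightarrow> 'm \<Rightarrow> 'm) \<Rightarrow> 'g tvec \<Rightarrow> 'm \<Rightarrow> 'm tvec" where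
  "inf_generator G M \<phi> \<xi> x = tangent_map (gmfd G) M (\<lambda>g. \<phi> g x) \<one>\<^bsub>G\<^esub> \<xi>"


section \<open>Vector bundles and Lie algebroids\<close>

record ('a, 'm) vbundle =
  total :: "'a mfd"
  base :: "'m mfd"
  proj :: "'a \<Rightarrow> 'm"
  vadd :: "'a \<Rightarrow> 'a \<Rightarrow> 'a"
  vscale :: "real \<Rightarrow> 'a \<Rightarrow> 'a"
  vrank :: nat

definition fibre :: "('a, 'm, 'z) vbundle_scheme \<Rightarrow> 'm \<Rightarrow> 'a set" where
  "fibre A x = {a \<in> pts (total A). proj A a = x}"

text \<open>
  In a local trivialization \<open>a \<mapsto> (\<tau> a, v a)\<close>, \<open>v\<close> is a bijection from each fibre onto \<open>\<real>\<^sup>r\<close>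
  compatible with the operations; this yields the vector space axioms in the fibres.
\<close>

definition vector_bundle :: "('a, 'm, 'z) vbundle_scheme \<Rightarrow> bool" where
  "vector_bundle A \<longleftrightarrow> smooth_manifold (total A) \<and> smooth_manifold (base A) \<and>
     smooth_map (total A) (base A) (proj A) \<and>
     (\<forall>x\<in>pts (base A). \<forall>a\<in>fibre A x. (\<forall>b\<in>fibre A x. vadd A a b \<in> fibre A x) \<and>
        (\<forall>c. vscale A c a \<in> fibre A x)) \<and>
     (\<forall>x\<in>pts (base A). \<exists>U v. openin (mtop (base A)) U \<and> x \<in> U \<and>
        diffeomorphism (open_submanifold (total A) {a \<in> pts (total A). proj A a \<in> U})
          (prod_mfd (open_submanifold (base A) U) (Rn (vrank A))) (\<lambda>a. (proj A a, v a)) \<and>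
        (\<forall>y\<in>U. \<forall>a\<in>fibre A y. (\<forall>b\<in>fibre A y. v (vadd A a b) = (\<lambda>i. v a i + v b i)) \<and>
           (\<forall>c. v (vscale A c a) = (\<lambda>i. c * v a i))))"

text \<open>Sections are normalized to be undefined outside the base.\<close>

definition sections :: "('a, 'm, 'z) vbundle_scheme \<Rightarrow> ('m \<Rightarrow> 'a) set" where
  "sections A = {X. smooth_map (base A) (total A) X \<and> (\<forall>x\<in>pts (base A). proj A (X x) = x) \<and>
     X \<in> extensional (pts (base A))}"

definition sec_add :: "('a, 'm, 'z) vbundle_scheme \<Rightarrow> ('m \<Rightarrow> 'a) \<Rightarrow> ('m \<Rightarrow> 'a) \<Rightarrow> 'm \<Rightarrow> 'a" where
  "sec_add A X Y = (\<lambda>x\<in>pts (base A). vadd A (X x) (Y x))"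

definition sec_scale :: "('a, 'm, 'z) vbundle_scheme \<Rightarrow> ('m \<Rightarrow> real) \<Rightarrow> ('m \<Rightarrow> 'a) \<Rightarrow> 'm \<Rightarrow> 'a" where
  "sec_scale A f X = (\<lambda>x\<in>pts (base A). vscale A (f x) (X x))"

definition vb_morphism :: "('a, 'm, 'z) vbundle_scheme \<Rightarrow> ('b, 'n, 'y) vbundle_scheme \<Rightarrow>
    ('a \<Rightarrow> 'b) \<Rightarrow> ('m \<Rightarrow> 'n) \<Rightarrow> bool" where
  "vb_morphism A A' F f \<longleftrightarrow> smooth_map (total A) (total A') F \<and> smooth_map (base A) (base A') f \<and>
     (\<forall>a\<in>pts (total A). proj A' (F a) = f (proj A a)) \<and>
     (\<forall>x\<in>pts (base A). \<forall>a\<in>fibre A x.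
        (\<forall>b\<in>fibre A x. F (vadd A a b) = vadd A' (F a) (F b)) \<and>
        (\<forall>c. F (vscale A c a) = vscale A' c (F a)))"

text \<open>
  Sections of \<open>\<Lambda>\<^sup>kA\<^sup>*\<close> are functions of a point \<open>x\<close> and a list of length \<open>k\<close> in the fibre over \<open>x\<close>.
  In particular, a function \<open>f\<close> is the form \<open>\<lambda>x _. f x\<close> of degree 0.
\<close>

type_synonym ('a, 'm) form = "'m \<Rightarrow> 'a list \<Rightarrow> real"

definition forms :: "('a, 'm, 'z) vbundle_scheme \<Rightarrow> nat \<Rightarrow> ('a, 'm) form set" where
  "forms A k = {\<omega>.
     (\<forall>x\<in>pts (base A). \<forall>as\<in>lists (fibre A x). length as = k \<longrightarrow>
        (\<forall>i<k. \<forall>b\<in>fibre A x.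
           (\<forall>c\<in>fibre A x. \<omega> x (as[i := vadd A b c]) = \<omega> x (as[i := b]) + \<omega> x (as[i := c])) \<and>
           (\<forall>r. \<omega> x (as[i := vscale A r b]) = r * \<omega> x (as[i := b]))) \<and>
        (\<forall>j<k. \<forall>i<j. as ! i = as ! j \<longrightarrow> \<omega> x as = 0)) \<and>
     (\<forall>Xs\<in>lists (sections A). length Xs = k \<longrightarrow>
        (\<lambda>x. \<omega> x (map (\<lambda>X. X x) Xs)) \<in> Cinf (base A))}"

record ('a, 'm) algebroid = "('a, 'm) vbundle" +
  anchor :: "'a \<Rightarrow> 'm tvec"
  bracket :: "('m \<Rightarrow> 'a) \<Rightarrow> ('m \<Rightarrow> 'a) \<Rightarrow> 'm \<Rightarrow> 'a"

definition lie_algebroid :: "('a, 'm) algebroid \<Rightarrow> bool" where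
  "lie_algebroid A \<longleftrightarrow> vector_bundle A \<and>
     smooth_map (total A) (tangent_bundle (base A)) (\<lambda>a. (proj A a, anchor A a)) \<and>
     (\<forall>x\<in>pts (base A). \<forall>a\<in>fibre A x.
        (\<forall>b\<in>fibre A x. anchor A (vadd A a b) = (\<lambda>h. anchor A a h + anchor A b h)) \<and>
        (\<forall>c. anchor A (vscale A c a) = (\<lambda>h. c * anchor A a h))) \<and>
     (\<forall>X\<in>sections A. \<forall>Y\<in>sections A. bracket A X Y \<in> sections A \<and>
        bracket A X Y = sec_scale A (\<lambda>_. -1) (bracket A Y X)) \<and>
     (\<forall>X\<in>sections A. \<forall>Y\<in>sections A. \<forall>Z\<in>sections A.
        bracket A X (sec_add A Y Z) = sec_add A (bracket A X Y) (bracket A X Z) \<and>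
        bracket A X (bracket A Y Z) =
          sec_add A (bracket A (bracket A X Y) Z) (bracket A Y (bracket A X Z))) \<and>
     (\<forall>X\<in>sections A. \<forall>Y\<in>sections A. \<forall>f\<in>Cinf (base A).
        bracket A X (sec_scale A f Y) =
          sec_add A (sec_scale A f (bracket A X Y)) (sec_scale A (\<lambda>x. anchor A (X x) f) Y))"

text \<open>
  The differential, by Cartan's formula. The degree is read off from the length of the
  argument list; the value at \<open>x\<close> is computed with arbitrary sections through the arguments.
\<close>

definition sec_through :: "('a, 'm) algebroid \<Rightarrow> 'm \<Rightarrow> 'a \<Rightarrow> 'm \<Rightarrow> 'a" where
  "sec_through A x a = (SOME X. X \<in> sections A \<and> X x = a)"

definition dA :: "('a, 'm) algebroid \<Rightarrow> ('a, 'm) form \<Rightarrow> ('a, 'm) form" where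
  "dA A \<omega> x as = (let Xs = map (sec_through A x) as in
     (\<Sum>i<length as. (-1) ^ i *
        anchor A (as ! i) (\<lambda>y. \<omega> y (map (\<lambda>X. X y) (nths Xs (- {i}))))) +
     (\<Sum>j<length as. \<Sum>i<j. (-1) ^ (i + j) *
        \<omega> x (bracket A (Xs ! i) (Xs ! j) x # map (\<lambda>X. X x) (nths Xs (- {i, j})))))"

definition interior :: "('m \<Rightarrow> 'a) \<Rightarrow> ('a, 'm) form \<Rightarrow> ('a, 'm) form" where
  "interior X \<omega> x as = \<omega> x (X x # as)"

definition lie_deriv :: "('a, 'm) algebroid \<Rightarrow> ('m \<Rightarrow> 'a) \<Rightarrow> ('a, 'm) form \<Rightarrow> ('a, 'm) form" where
  "lie_deriv A X \<omega> x as = interior X (dA A \<omega>) x as + dA A (interior X \<omega>) x as"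

definition pullback :: "('a \<Rightarrow> 'b) \<Rightarrow> ('m \<Rightarrow> 'n) \<Rightarrow> ('b, 'n) form \<Rightarrow> ('a, 'm) form" where
  "pullback F f \<omega> x as = \<omega> (f x) (map F as)"

definition form_eq ::
  "('a, 'm, 'z) vbundle_scheme \<Rightarrow> nat \<Rightarrow> ('a, 'm) form \<Rightarrow> ('a, 'm) form \<Rightarrow> bool" where
  "form_eq A k \<omega> \<eta> \<longleftrightarrow>
     (\<forall>x\<in>pts (base A). \<forall>as\<in>lists (fibre A x). length as = k \<longrightarrow> \<omega> x as = \<eta> x as)"

definition lie_algebroid_morphism ::
  "('a, 'm) algebroid \<Rightarrow> ('b, 'n) algebroid \<Rightarrow> ('a \<Rightarrow> 'b) \<Rightarrow> ('m \<Rightarrow> 'n) \<Rightarrow> bool" where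
  "lie_algebroid_morphism A A' F f \<longleftrightarrow> vb_morphism A A' F f \<and>
     (\<forall>k. \<forall>\<omega>\<in>forms A' k.
        form_eq A (Suc k) (dA A (pullback F f \<omega>)) (pullback F f (dA A' \<omega>)))"

definition lie_algebroid_epimorphism ::
  "('a, 'm) algebroid \<Rightarrow> ('b, 'n) algebroid \<Rightarrow> ('a \<Rightarrow> 'b) \<Rightarrow> ('m \<Rightarrow> 'n) \<Rightarrow> bool" where
  "lie_algebroid_epimorphism A A' F f \<longleftrightarrow> lie_algebroid_morphism A A' F f \<and>
     f ` pts (base A) = pts (base A') \<and> submersion (base A) (base A') f \<and>
     (\<forall>x\<in>pts (base A). F ` fibre A x = fibre A' (f x))"

definition lie_subalgebroid :: "('a, 'm) algebroid \<Rightarrow> ('a, 'm) algebroid \<Rightarrow> bool" where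
  "lie_subalgebroid A B \<longleftrightarrow> lie_algebroid B \<and>
     embedded_submanifold (total A) (total B) \<and> embedded_submanifold (base A) (base B) \<and>
     lie_algebroid_morphism B A (\<lambda>a. a) (\<lambda>x. x)"

definition lin_fun :: "('a, 'm, 'z) vbundle_scheme \<Rightarrow> ('a, 'm) form \<Rightarrow> 'a \<Rightarrow> real" where
  "lin_fun A \<beta> a = \<beta> (proj A a) [a]"

definition complete_lift :: "('a, 'm) algebroid \<Rightarrow> ('m \<Rightarrow> 'a) \<Rightarrow> ('a \<Rightarrow> 'a tvec) \<Rightarrow> bool" where
  "complete_lift A X Z \<longleftrightarrow> vector_field (total A) Z \<and>
     (\<forall>a\<in>pts (total A). tangent_map (total A) (base A) (proj A) a (Z a) = anchor A (X (proj A a))) \<and>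
     (\<forall>\<beta>\<in>forms A 1. \<forall>a\<in>pts (total A). Z a (lin_fun A \<beta>) = lin_fun A (lie_deriv A X \<beta>) a)"


section \<open>Symplectic-like Lie algebroids\<close>

definition symplectic_like :: "('a, 'm) algebroid \<Rightarrow> ('a, 'm) form \<Rightarrow> bool" where
  "symplectic_like A \<Omega> \<longleftrightarrow> lie_algebroid A \<and> \<Omega> \<in> forms A 2 \<and> form_eq A 3 (dA A \<Omega>) (\<lambda>_ _. 0) \<and>
     (\<forall>x\<in>pts (base A). \<forall>a\<in>fibre A x.
        (\<forall>b\<in>fibre A x. \<Omega> x [a, b] = 0) \<longrightarrow> a = vscale A 0 a)"

definition ham_section ::
  "('a, 'm) algebroid \<Rightarrow> ('a, 'm) form \<Rightarrow> ('m \<Rightarrow> real) \<Rightarrow> 'm \<Rightarrow> 'a" where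
  "ham_section A \<Omega> f = (\<lambda>x\<in>pts (base A).
     THE a. a \<in> fibre A x \<and> (\<forall>b\<in>fibre A x. \<Omega> x [a, b] = dA A (\<lambda>y _. f y) x [b]))"

definition poisson ::
  "('a, 'm) algebroid \<Rightarrow> ('a, 'm) form \<Rightarrow> ('m \<Rightarrow> real) \<Rightarrow> ('m \<Rightarrow> real) \<Rightarrow> 'm \<Rightarrow> real" where
  "poisson A \<Omega> f g x = anchor A (ham_section A \<Omega> g x) f"


section \<open>Hamiltonian actions and reduction\<close>

definition lie_alg_antimorphism ::
  "'g lie_group \<Rightarrow> ('a, 'm) algebroid \<Rightarrow> ('g tvec \<Rightarrow> 'm \<Rightarrow> 'a) \<Rightarrow> bool" where
  "lie_alg_antimorphism G A \<psi> \<longleftrightarrow>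
     (\<forall>\<xi>\<in>lie_alg G. \<psi> \<xi> \<in> sections A \<and>
        (\<forall>c. \<psi> (\<lambda>h. c * \<xi> h) = sec_scale A (\<lambda>_. c) (\<psi> \<xi>)) \<and>
        (\<forall>\<eta>\<in>lie_alg G. \<psi> (\<lambda>h. \<xi> h + \<eta> h) = sec_add A (\<psi> \<xi>) (\<psi> \<eta>) \<and>
           \<psi> (lie_alg_bracket G \<xi> \<eta>) = sec_scale A (\<lambda>_. -1) (bracket A (\<psi> \<xi>) (\<psi> \<eta>))))"

definition action_by_complete_lifts ::
  "'g lie_group \<Rightarrow> ('a, 'm) algebroid \<Rightarrow> ('g \<Rightarrow> 'a \<Rightarrow> 'a) \<Rightarrow> ('g \<Rightarrow> 'm \<Rightarrow> 'm) \<Rightarrow>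
     ('g tvec \<Rightarrow> 'm \<Rightarrow> 'a) \<Rightarrow> bool" where
  "action_by_complete_lifts G A \<Phi> \<phi> \<psi> \<longleftrightarrow>
     smooth_left_action G (total A) \<Phi> \<and> smooth_left_action G (base A) \<phi> \<and>
     (\<forall>g\<in>carrier G. vb_morphism A A (\<Phi> g) (\<phi> g)) \<and>
     lie_alg_antimorphism G A \<psi> \<and>
     (\<forall>\<xi>\<in>lie_alg G. complete_lift A (\<psi> \<xi>) (inf_generator G (total A) \<Phi> \<xi>))"

definition momentum_map ::
  "'g lie_group \<Rightarrow> 'm mfd \<Rightarrow> ('m \<Rightarrow> 'g tvec \<Rightarrow> real) \<Rightarrow> bool" where
  "momentum_map G M J \<longleftrightarrow> (\<forall>x\<in>pts M. J x \<in> lie_dual G) \<and>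
     (\<forall>\<xi>\<in>lie_alg G. (\<lambda>x. J x \<xi>) \<in> Cinf M)"

definition hamiltonian_action ::
  "'g lie_group \<Rightarrow> ('a, 'm) algebroid \<Rightarrow> ('a, 'm) form \<Rightarrow> ('g \<Rightarrow> 'a \<Rightarrow> 'a) \<Rightarrow> ('g \<Rightarrow> 'm \<Rightarrow> 'm) \<Rightarrow>
     ('g tvec \<Rightarrow> 'm \<Rightarrow> 'a) \<Rightarrow> ('m \<Rightarrow> 'g tvec \<Rightarrow> real) \<Rightarrow> bool" where
  "hamiltonian_action G A \<Omega> \<Phi> \<phi> \<psi> J \<longleftrightarrow>
     action_by_complete_lifts G A \<Phi> \<phi> \<psi> \<and> momentum_map G (base A) J \<and>
     (\<forall>g\<in>carrier G. \<forall>x\<in>pts (base A). J (\<phi> g x) = Coad G g (J x)) \<and>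
     (\<forall>g\<in>carrier G. form_eq A 2 (pullback (\<Phi> g) (\<phi> g) \<Omega>) \<Omega>) \<and>
     (\<forall>\<xi>\<in>lie_alg G. form_eq A 1 (interior (\<psi> \<xi>) \<Omega>) (dA A (\<lambda>x _. J x \<xi>)))"

text \<open>
  The tangent map of \<open>J\<close>, with tangent spaces of the vector space \<open>\<gg>\<^sup>*\<close> identified with \<open>\<gg>\<^sup>*\<close> in the
  canonical way: \<open>(TJ v)(\<xi>) = v(J\<^sub>\<xi>)\<close>. The base point does not enter the formula.
\<close>

definition TJ :: "'g lie_group \<Rightarrow> ('m \<Rightarrow> 'g tvec \<Rightarrow> real) \<Rightarrow> 'm tvec \<Rightarrow> 'g tvec \<Rightarrow> real" where
  "TJ G J v = (\<lambda>\<xi>. if \<xi> \<in> lie_alg G then v (\<lambda>y. J y \<xi>) else 0)"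

definition level_set :: "'m mfd \<Rightarrow> ('m \<Rightarrow> 'g tvec \<Rightarrow> real) \<Rightarrow> ('g tvec \<Rightarrow> real) \<Rightarrow> 'm set" where
  "level_set M J \<mu> = {x \<in> pts M. J x = \<mu>}"

definition regular_value ::
  "'g lie_group \<Rightarrow> 'm mfd \<Rightarrow> ('m \<Rightarrow> 'g tvec \<Rightarrow> real) \<Rightarrow> ('g tvec \<Rightarrow> real) \<Rightarrow> bool" where
  "regular_value G M J \<mu> \<longleftrightarrow> \<mu> \<in> lie_dual G \<and>
     (\<forall>x\<in>level_set M J \<mu>. TJ G J ` tangent_space M x = lie_dual G)"

definition constant_rank_on_level ::
  "'g lie_group \<Rightarrow> ('a, 'm) algebroid \<Rightarrow> ('m \<Rightarrow> 'g tvec \<Rightarrow> real) \<Rightarrow> ('g tvec \<Rightarrow> real) \<Rightarrow> bool" where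
  "constant_rank_on_level G A J \<mu> \<longleftrightarrow> (\<exists>r. \<forall>x\<in>level_set (base A) J \<mu>.
     vector_space.dim (\<lambda>c (\<nu> :: 'g tvec \<Rightarrow> real) \<xi>. c * \<nu> \<xi>)
       ((\<lambda>a. TJ G J (anchor A a)) ` fibre A x) = r)"

definition free_action_on :: "'g lie_group \<Rightarrow> 'g set \<Rightarrow> 'm set \<Rightarrow> ('g \<Rightarrow> 'm \<Rightarrow> 'm) \<Rightarrow> bool" where
  "free_action_on G H N \<phi> \<longleftrightarrow> (\<forall>g\<in>H. \<forall>x\<in>N. \<phi> g x = x \<longrightarrow> g = \<one>\<^bsub>G\<^esub>)"

definition proper_action_on ::
  "'g lie_group \<Rightarrow> 'g set \<Rightarrow> 'm mfd \<Rightarrow> 'm set \<Rightarrow> ('g \<Rightarrow> 'm \<Rightarrow> 'm) \<Rightarrow> bool" where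
  "proper_action_on G H M N \<phi> \<longleftrightarrow>
     proper_map
       (prod_topology (subtopology (mtop (gmfd G)) H) (subtopology (mtop M) N))
       (prod_topology (subtopology (mtop M) N) (subtopology (mtop M) N))
       (\<lambda>(g, x). (\<phi> g x, x))"

definition JT :: "'g lie_group \<Rightarrow> ('a, 'm) algebroid \<Rightarrow> ('m \<Rightarrow> 'g tvec \<Rightarrow> real) \<Rightarrow>
    'a \<Rightarrow> ('g tvec \<Rightarrow> real) \<times> ('g tvec \<Rightarrow> real)" where
  "JT G A J a = (TJ G J (anchor A a), J (proj A a))"

text \<open>
  The projections onto the orbit spaces of \<open>G\<^sub>\<mu>\<close> on the level set and of \<open>TG\<^sub>\<mu> \<cong> G\<^sub>\<mu> \<times> \<gg>\<^sub>\<mu>\<close> on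
  \<open>(J\<^sup>T)\<^sup>-\<^sup>1(0,\<mu>)\<close>. Points of the orbit spaces are the orbits themselves.
\<close>

definition base_orbit ::
  "'g lie_group \<Rightarrow> ('g tvec \<Rightarrow> real) \<Rightarrow> ('g \<Rightarrow> 'm \<Rightarrow> 'm) \<Rightarrow> 'm \<Rightarrow> 'm set" where
  "base_orbit G \<mu> \<phi> x = (\<lambda>g. \<phi> g x) ` isotropy G \<mu>"

definition TG_action :: "('a, 'm) algebroid \<Rightarrow> ('g \<Rightarrow> 'a \<Rightarrow> 'a) \<Rightarrow> ('g tvec \<Rightarrow> 'm \<Rightarrow> 'a) \<Rightarrow>
    'g \<times> 'g tvec \<Rightarrow> 'a \<Rightarrow> 'a" where
  "TG_action A \<Phi> \<psi> = (\<lambda>(g, \<xi>) a. \<Phi> g (vadd A a (\<psi> \<xi> (proj A a))))"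

definition total_orbit :: "'g lie_group \<Rightarrow> ('a, 'm) algebroid \<Rightarrow> ('g tvec \<Rightarrow> real) \<Rightarrow>
    ('g \<Rightarrow> 'a \<Rightarrow> 'a) \<Rightarrow> ('g tvec \<Rightarrow> 'm \<Rightarrow> 'a) \<Rightarrow> 'a \<Rightarrow> 'a set" where
  "total_orbit G A \<mu> \<Phi> \<psi> a =
     (\<lambda>u. TG_action A \<Phi> \<psi> u a) ` (isotropy G \<mu> \<times> isotropy_alg G \<mu>)"

text \<open>
  \<open>B\<close> is \<open>(J\<^sup>T)\<^sup>-\<^sup>1(0,\<mu>)\<close> as a Lie subalgebroid of \<open>A\<close> over the level set, and \<open>(C, \<Omega>\<^sub>\<mu>)\<close> is the reduced
  symplectic-like Lie algebroid \<open>A\<^sub>\<mu>\<close> over the orbit space of the level set. The conditions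
  determine these structures (manifold structures up to the choice of an atlas).
\<close>

definition reduced_algebroid ::
  "'g lie_group \<Rightarrow> ('a, 'm) algebroid \<Rightarrow> ('a, 'm) form \<Rightarrow> ('g \<Rightarrow> 'a \<Rightarrow> 'a) \<Rightarrow> ('g \<Rightarrow> 'm \<Rightarrow> 'm) \<Rightarrow>
     ('g tvec \<Rightarrow> 'm \<Rightarrow> 'a) \<Rightarrow> ('m \<Rightarrow> 'g tvec \<Rightarrow> real) \<Rightarrow> ('g tvec \<Rightarrow> real) \<Rightarrow>
     ('a, 'm) algebroid \<Rightarrow> ('a set, 'm set) algebroid \<Rightarrow> ('a set, 'm set) form \<Rightarrow> bool" where
  "reduced_algebroid G A \<Omega> \<Phi> \<phi> \<psi> J \<mu> B C \<Omega>\<^sub>\<mu> \<longleftrightarrow>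
     lie_subalgebroid A B \<and>
     pts (total B) = {a \<in> pts (total A). JT G A J a = ((\<lambda>_. 0), \<mu>)} \<and>
     pts (base B) = level_set (base A) J \<mu> \<and>
     symplectic_like C \<Omega>\<^sub>\<mu> \<and>
     pts (total C) = total_orbit G A \<mu> \<Phi> \<psi> ` pts (total B) \<and>
     pts (base C) = base_orbit G \<mu> \<phi> ` pts (base B) \<and>
     lie_algebroid_epimorphism B C (total_orbit G A \<mu> \<Phi> \<psi>) (base_orbit G \<mu> \<phi>) \<and>
     form_eq B 2 (pullback (total_orbit G A \<mu> \<Phi> \<psi>) (base_orbit G \<mu> \<phi>) \<Omega>\<^sub>\<mu>)
       (pullback (\<lambda>a. a) (\<lambda>x. x) \<Omega>)"

end

theory Submission
  imports Defs
begin

text \<open>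
  Let \<open>x \<in> J\<^sup>-\<^sup>1(\<mu>)\<close> and let \<open>h\<close> be the value at \<open>x\<close> of the Hamiltonian section of \<open>g\<close>. As \<open>\<rho>(\<psi>(\<xi>))\<close>
  generates the action on the base and \<open>g\<close> is invariant,
  \<open>\<rho>(h)(J\<^sub>\<xi>) = \<Omega>(\<psi>(\<xi>), h) = - \<rho>(\<psi>(\<xi>))(g) = 0\<close>, so \<open>h\<close> lies in \<open>(J\<^sup>T)\<^sup>-\<^sup>1(0,\<mu>)\<close>. The projection to
  \<open>A\<^sub>\<mu>\<close> is fibrewise surjective, pulls \<open>\<Omega>\<^sub>\<mu>\<close> back to \<open>\<Omega>\<close> and commutes with the differentials, hence it
  maps \<open>h\<close> to the Hamiltonian section of \<open>g\<^sub>\<mu>\<close>; the brackets are the derivatives of \<open>f\<close> and \<open>f\<^sub>\<mu>\<close>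
  along these two elements.

  The chain rule is never needed: a tangent vector vanishes on functions that are not smooth near its
  base point, and this smoothness depends only on the values on the manifold.
\<close>

section \<open>Smooth functions and tangent vectors\<close>

text \<open>\<open>mtop\<close> is built with \<open>topology\<close>, so its open sets are known
  only once the axioms are checked. Injectivity of the charts lets images commute with
  intersections.\<close>

lemma istopology_charts:
  assumes "\<forall>c\<in>charts M. is_chart (mdim M) c"
  shows "istopology (\<lambda>W. W \<subseteq> pts M \<and>
     (\<forall>(U, \<phi>)\<in>charts M. openin (Euclidean_space (mdim M)) (\<phi> ` (U \<inter> W))))"
  unfolding istopology_def
proof (intro conjI allI impI)
  fix S T
  assume S: "S \<subseteq> pts M \<and> (\<forall>(U, \<phi>)\<in>charts M. openin (Euclidean_space (mdim M)) (\<phi> ` (U \<inter> S)))"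
    and T: "T \<subseteq> pts M \<and> (\<forall>(U, \<phi>)\<in>charts M. openin (Euclidean_space (mdim M)) (\<phi> ` (U \<inter> T)))"
  show "S \<inter> T \<subseteq> pts M" using S by blast
  show "\<forall>(U, \<phi>)\<in>charts M. openin (Euclidean_space (mdim M)) (\<phi> ` (U \<inter> (S \<inter> T)))"
  proof clarify
    fix U \<phi> assume c: "(U, \<phi>) \<in> charts M"
    then have "inj_on \<phi> U" using assms by (auto simp: is_chart_def)
    then have "\<phi> ` (U \<inter> (S \<inter> T)) = \<phi> ` (U \<inter> S) \<inter> \<phi> ` (U \<inter> T)"
      by (auto simp: inj_on_def)
    then show "openin (Euclidean_space (mdim M)) (\<phi> ` (U \<inter> (S \<inter> T)))"
      using S T c by (auto intro!: openin_Int)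
  qed
next
  fix K
  assume K: "\<forall>S\<in>K. S \<subseteq> pts M \<and>
    (\<forall>(U, \<phi>)\<in>charts M. openin (Euclidean_space (mdim M)) (\<phi> ` (U \<inter> S)))"
  show "\<Union>K \<subseteq> pts M" using K by blast
  show "\<forall>(U, \<phi>)\<in>charts M. openin (Euclidean_space (mdim M)) (\<phi> ` (U \<inter> \<Union>K))"
  proof clarify
    fix U \<phi> assume c: "(U, \<phi>) \<in> charts M"
    have "\<phi> ` (U \<inter> \<Union>K) = \<Union>((\<lambda>S. \<phi> ` (U \<inter> S)) ` K)" by blast
    then show "openin (Euclidean_space (mdim M)) (\<phi> ` (U \<inter> \<Union>K))"
      using K c by (auto intro!: openin_Union)
  qed
qed

lemma openin_mtop_iff:
  assumes "smooth_manifold M"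
  shows "openin (mtop M) W \<longleftrightarrow> W \<subseteq> pts M \<and>
     (\<forall>(U, \<phi>)\<in>charts M. openin (Euclidean_space (mdim M)) (\<phi> ` (U \<inter> W)))"
proof -
  have "\<forall>c\<in>charts M. is_chart (mdim M) c" using assms by (simp add: smooth_manifold_def)
  then show ?thesis
    unfolding mtop_def by (simp only: topology_inverse'[OF istopology_charts])
qed

lemma openin_pts:
  assumes "smooth_manifold M"
  shows "openin (mtop M) (pts M)"
proof -
  have "openin (Euclidean_space (mdim M)) (\<phi> ` (U \<inter> pts M))" if c: "(U, \<phi>) \<in> charts M" for U \<phi>
  proof -
    have "U \<inter> pts M = U" using c by (auto simp: pts_def)
    moreover have "is_chart (mdim M) (U, \<phi>)" using assms c unfolding smooth_manifold_def by blast
    ultimately show ?thesis by (simp add: is_chart_def)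
  qed
  then show ?thesis unfolding openin_mtop_iff[OF assms] by blast
qed

text \<open>Makes partial derivatives local: for \<open>i < n\<close> the coordinate line through
  \<open>x\<close> is a continuous curve in \<open>Euclidean_space n\<close>, so it stays in
  \<open>W\<close> for parameters near \<open>x i\<close>.\<close>

lemma eventually_fun_upd_in_open:
  assumes "openin (Euclidean_space n) W" "x \<in> W" "i < n"
  shows "eventually (\<lambda>t. x(i := t) \<in> W) (nhds (x i))"
proof -
  have x: "\<forall>j\<ge>n. x j = 0"
    using openin_subset[OF assms(1)] assms(2) by (auto simp: topspace_Euclidean_space)
  have c: "continuous_map euclideanreal (Euclidean_space n) (\<lambda>t. x(i := t))"
    unfolding Euclidean_space_def continuous_map_in_subtopology continuous_map_componentwise_UNIV
    using x assms(3) by auto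
  have "open {t. x(i := t) \<in> W}"
    using openin_continuous_map_preimage[OF c assms(1)] by simp
  then show ?thesis
    using assms(2) by (auto simp: eventually_nhds intro!: exI[of _ "{t. x(i := t) \<in> W}"])
qed

text \<open>Each partial derivative at a point of the open set \<open>W\<close> depends only on
  values in \<open>W\<close>. The induction varies \<open>f\<close> and \<open>g\<close>, since the
  next order concerns their partial derivatives.\<close>

lemma diff_class_cong:
  assumes "openin (Euclidean_space n) W" "\<And>x. x \<in> W \<Longrightarrow> f x = g x" "diff_class n W k f"
  shows "diff_class n W k g"
  using assms(2,3)
proof (induction k arbitrary: f g)
  case (0 f g)
  then show ?case
    by (auto intro: continuous_map_eq)
next
  case (Suc k f g)
  have prems: "continuous_map (subtopology (Euclidean_space n) W) euclideanreal f"
    "\<And>x i. i < n \<Longrightarrow> x \<in> W \<Longrightarrow> (\<lambda>t. f (x(i := t))) differentiable at (x i)"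
    "\<And>i. i < n \<Longrightarrow> diff_class n W k (partial_deriv i f)"
    using Suc.prems(2) unfolding diff_class.simps by blast+
  have cont: "continuous_map (subtopology (Euclidean_space n) W) euclideanreal g"
    using prems(1) by (rule continuous_map_eq) (simp add: Suc.prems(1))
  have ev: "eventually (\<lambda>t. f (x(i := t)) = g (x(i := t))) (nhds (x i))"
    if "x \<in> W" "i < n" for x i
    using eventually_fun_upd_in_open[OF assms(1) that] by eventually_elim (rule Suc.prems(1))
  have d: "(\<lambda>t. g (x(i := t))) differentiable at (x i)" if "x \<in> W" "i < n" for x i
  proof -
    have "(\<lambda>t. f (x(i := t))) differentiable at (x i)"
      using prems(2) that by blast
    then obtain D where "((\<lambda>t. f (x(i := t))) has_real_derivative D) (at (x i))"
      unfolding real_differentiable_def by blast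
    then have "((\<lambda>t. g (x(i := t))) has_real_derivative D) (at (x i))"
      using DERIV_cong_ev[OF refl ev[OF that] refl] by blast
    then show ?thesis by (auto simp: real_differentiable_def)
  qed
  have p: "partial_deriv i f x = partial_deriv i g x" if "x \<in> W" "i < n" for x i
    unfolding partial_deriv_def using ev[OF that] by (rule deriv_cong_ev) simp
  have "diff_class n W k (partial_deriv i g)" if "i < n" for i
  proof (rule Suc.IH)
    show "partial_deriv i f x = partial_deriv i g x" if "x \<in> W" for x
      using p that \<open>i < n\<close> by blast
    show "diff_class n W k (partial_deriv i f)" using prems(3) that by blast
  qed
  then show ?case using cont d unfolding diff_class.simps by blast
qed

lemma smooth_atI:
  assumes "(U, \<phi>) \<in> charts M" "x \<in> U" "openin (Euclidean_space (mdim M)) W" "\<phi> x \<in> W" "W \<subseteq> \<phi> ` U"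
    and "smooth_on_Rn (mdim M) W (f \<circ> inv_into U \<phi>)"
  shows "smooth_at M x f"
  unfolding smooth_at_def
proof (rule bexI[OF _ assms(1)], unfold prod.case, intro conjI exI)
qed (fact assms)+

text \<open>\<open>inv_into U \<phi>\<close> sends \<open>W\<close> into \<open>U\<close>, inside
  \<open>pts M\<close>, so both functions have the same coordinate expression on
  \<open>W\<close>.\<close>

lemma smooth_at_cong:
  assumes "\<And>y. y \<in> pts M \<Longrightarrow> f y = g y" "smooth_at M x f"
  shows "smooth_at M x g"
proof -
  obtain U \<phi> W where c: "(U, \<phi>) \<in> charts M" "x \<in> U"
    and W: "openin (Euclidean_space (mdim M)) W" "\<phi> x \<in> W" "W \<subseteq> \<phi> ` U"
    and s: "smooth_on_Rn (mdim M) W (f \<circ> inv_into U \<phi>)"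
    using assms(2) unfolding smooth_at_def by blast
  have "U \<subseteq> pts M" using c(1) by (auto simp: pts_def)
  then have eq: "(f \<circ> inv_into U \<phi>) y = (g \<circ> inv_into U \<phi>) y" if "y \<in> W" for y
    using assms(1)[of "inv_into U \<phi> y"] inv_into_into[of y \<phi> U] W(3) that by (simp add: subset_iff)
  have "diff_class (mdim M) W k (g \<circ> inv_into U \<phi>)" for k
  proof (rule diff_class_cong[OF W(1) eq])
    show "diff_class (mdim M) W k (f \<circ> inv_into U \<phi>)" using s by (simp add: smooth_on_Rn_def)
  qed
  then have "smooth_on_Rn (mdim M) W (g \<circ> inv_into U \<phi>)" by (simp add: smooth_on_Rn_def)
  then show ?thesis using c W by (intro smooth_atI)
qed

lemma diff_class_const: "diff_class n W k (\<lambda>_. c)"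
proof (induction k arbitrary: c)
  case (Suc k)
  have "partial_deriv i (\<lambda>_. c) = (\<lambda>_. 0)" for i
    by (simp add: fun_eq_iff partial_deriv_def)
  then show ?case using Suc by simp
qed simp

lemma smooth_at_const:
  assumes "smooth_manifold M" "x \<in> pts M"
  shows "smooth_at M x (\<lambda>_. c)"
proof -
  obtain U \<phi> where c: "(U, \<phi>) \<in> charts M" "x \<in> U"
    using assms(2) by (auto simp: pts_def)
  then have "is_chart (mdim M) (U, \<phi>)" using assms(1) unfolding smooth_manifold_def by blast
  then have "openin (Euclidean_space (mdim M)) (\<phi> ` U)" by (simp add: is_chart_def)
  then show ?thesis
    using c by (intro smooth_atI[of U \<phi> M x "\<phi> ` U"]) (auto simp: smooth_on_Rn_def comp_def diff_class_const)
qed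

section \<open>Tangent vectors as derivations\<close>

lemma tangent_vector_germ:
  assumes "D \<in> tangent_space M x" "smooth_at M x f" "smooth_at M x g"
    and "openin (mtop M) W" "x \<in> W" "\<forall>y\<in>W. f y = g y"
  shows "D f = D g"
proof -
  have "\<forall>f g. smooth_at M x f \<longrightarrow> smooth_at M x g \<longrightarrow>
        (\<exists>W. openin (mtop M) W \<and> x \<in> W \<and> (\<forall>y\<in>W. f y = g y)) \<longrightarrow> D f = D g"
    using assms(1) unfolding tangent_space_def mem_Collect_eq by (elim conjE)
  then show ?thesis using assms(2-) by blast
qed

lemma tangent_vector_base: "D \<in> tangent_space M x \<Longrightarrow> x \<in> pts M"
  unfolding tangent_space_def by blast

lemma tangent_vector_not_smooth: "D \<in> tangent_space M x \<Longrightarrow> \<not> smooth_at M x f \<Longrightarrow> D f = 0"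
  unfolding tangent_space_def by blast

lemma tangent_vector_mult:
  assumes "D \<in> tangent_space M x" "smooth_at M x f" "smooth_at M x g"
  shows "D (\<lambda>y. f y * g y) = D f * g x + f x * D g"
  using assms unfolding tangent_space_def by blast

lemma tangent_vector_scale:
  assumes "D \<in> tangent_space M x" "smooth_at M x f"
  shows "D (\<lambda>y. c * f y) = c * D f"
  using assms unfolding tangent_space_def by blast

text \<open>If one function is smooth at \<open>x\<close>, so is the other, and they share a germ
  with all of \<open>pts M\<close> as neighbourhood; otherwise \<open>D\<close> gives both the
  default value 0.\<close>

lemma tangent_vector_cong:
  assumes "smooth_manifold M" "D \<in> tangent_space M x" "\<And>y. y \<in> pts M \<Longrightarrow> f y = g y"
  shows "D f = D g"
proof (cases "smooth_at M x f")
  case True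
  then have "smooth_at M x g" using smooth_at_cong[of M f g x] assms(3) by blast
  then show ?thesis
    using tangent_vector_germ[OF assms(2) True _ openin_pts[OF assms(1)]]
      tangent_vector_base[OF assms(2)] assms(3) by blast
next
  case False
  then have "\<not> smooth_at M x g" using smooth_at_cong[of M g f x] assms(3)[symmetric] by blast
  then show ?thesis
    using False tangent_vector_not_smooth[OF assms(2)] by simp
qed

text \<open>The Leibniz rule for the product of 1 with itself gives D(1) = 2 D(1). As
  \<open>f\<close> is constant only on \<open>pts M\<close>, the literal constant function stands in
  for it.\<close>

lemma tangent_vector_const:
  assumes "smooth_manifold M" "D \<in> tangent_space M x" "\<And>y. y \<in> pts M \<Longrightarrow> f y = c"
  shows "D f = 0"
proof -
  have s: "smooth_at M x (\<lambda>_. 1)"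
    by (rule smooth_at_const[OF assms(1) tangent_vector_base[OF assms(2)]])
  have "D (\<lambda>_. 1) = 0"
    using tangent_vector_mult[OF assms(2) s s] by simp
  moreover have "D (\<lambda>_. c) = c * D (\<lambda>_. 1)"
    using tangent_vector_scale[OF assms(2) s, of c] by simp
  ultimately have "D (\<lambda>_. c) = 0" by simp
  then show ?thesis using tangent_vector_cong[OF assms(1,2), of f "\<lambda>_. c"] assms(3) by simp
qed

section \<open>Linear forms on the fibres\<close>

text \<open>Fibres are sets with operations taken from the record; vectors in them are handled below
  through the values of linear forms.\<close>

definition fibre_linear :: "('a, 'm, 'z) vbundle_scheme \<Rightarrow> 'm \<Rightarrow> ('a \<Rightarrow> real) \<Rightarrow> bool" where
  "fibre_linear A x L \<longleftrightarrow> (\<forall>a\<in>fibre A x.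
     (\<forall>b\<in>fibre A x. L (vadd A a b) = L a + L b) \<and> (\<forall>c. L (vscale A c a) = c * L a))"

lemma fibre_linear_add:
  "fibre_linear A x L \<Longrightarrow> a \<in> fibre A x \<Longrightarrow> b \<in> fibre A x \<Longrightarrow> L (vadd A a b) = L a + L b"
  by (simp add: fibre_linear_def)

lemma fibre_linear_scale:
  "fibre_linear A x L \<Longrightarrow> a \<in> fibre A x \<Longrightarrow> L (vscale A c a) = c * L a"
  by (simp add: fibre_linear_def)

lemma vadd_in_fibre:
  "vector_bundle A \<Longrightarrow> x \<in> pts (base A) \<Longrightarrow> a \<in> fibre A x \<Longrightarrow> b \<in> fibre A x \<Longrightarrow> vadd A a b \<in> fibre A x"
  by (simp add: vector_bundle_def)

lemma vscale_in_fibre: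
  "vector_bundle A \<Longrightarrow> x \<in> pts (base A) \<Longrightarrow> a \<in> fibre A x \<Longrightarrow> vscale A c a \<in> fibre A x"
  by (simp add: vector_bundle_def)

section \<open>Coordinates and bases in a fibre\<close>

lemma pts_open_submanifold: "pts (open_submanifold M W) = pts M \<inter> W"
proof -
  have "charts (open_submanifold M W) = (\<lambda>(U, \<phi>). (U \<inter> W, \<phi>)) ` charts M"
    unfolding open_submanifold_def by force
  then show ?thesis unfolding pts_def by (simp add: case_prod_unfold)
qed

lemma pts_Rn: "pts (Rn n) = {u. \<forall>i\<ge>n. u i = 0}"
  by (simp add: pts_def Rn_def topspace_Euclidean_space)

lemma pts_prod_mfd: "pts (prod_mfd M N) = pts M \<times> pts N"
proof -
  have "charts (prod_mfd M N) = (\<lambda>((U, \<phi>), V, \<psi>). (U \<times> V,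
      \<lambda>(x, y) i. if i < mdim M then \<phi> x i else \<psi> y (i - mdim M))) ` (charts M \<times> charts N)"
    unfolding prod_mfd_def by force
  then show ?thesis unfolding pts_def by (auto simp: case_prod_unfold)
qed

text \<open>Over the fixed point \<open>x\<close> the first component of a local trivialization is
  constant, so the second one alone is a bijection onto the coordinate space.\<close>

lemma fibre_coordinates:
  assumes "vector_bundle A" "x \<in> pts (base A)"
  obtains v where "bij_betw v (fibre A x) {u. \<forall>i\<ge>vrank A. u i = (0::real)}"
    and "\<And>i. fibre_linear A x (\<lambda>a. v a i)"
proof -
  obtain U v where U: "openin (mtop (base A)) U" "x \<in> U"
    and d: "diffeomorphism (open_submanifold (total A) {a \<in> pts (total A). proj A a \<in> U})
          (prod_mfd (open_submanifold (base A) U) (Rn (vrank A))) (\<lambda>a. (proj A a, v a))"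
    and l: "\<forall>y\<in>U. \<forall>a\<in>fibre A y. (\<forall>b\<in>fibre A y. v (vadd A a b) = (\<lambda>i. v a i + v b i)) \<and>
           (\<forall>c. v (vscale A c a) = (\<lambda>i. c * v a i))"
    using assms(1)[unfolded vector_bundle_def, THEN conjunct2, THEN conjunct2, THEN conjunct2,
        THEN conjunct2, THEN bspec, OF assms(2)] by (elim exE conjE)
  have i: "pts (total A) \<inter> {a \<in> pts (total A). proj A a \<in> U} = {a \<in> pts (total A). proj A a \<in> U}"
    by blast
  have b: "bij_betw (\<lambda>a. (proj A a, v a)) {a \<in> pts (total A). proj A a \<in> U}
      ((pts (base A) \<inter> U) \<times> {u. \<forall>i\<ge>vrank A. u i = 0})"
    using d unfolding diffeomorphism_def pts_open_submanifold pts_prod_mfd pts_Rn i by (elim conjE)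
  have "inj_on v (fibre A x)"
  proof (rule inj_onI)
    fix a c assume "a \<in> fibre A x" "c \<in> fibre A x" "v a = v c"
    then show "a = c"
      using U(2) by (intro inj_onD[OF bij_betw_imp_inj_on[OF b]]) (simp_all add: fibre_def)
  qed
  moreover have "v ` fibre A x = {u. \<forall>i\<ge>vrank A. u i = 0}"
  proof (intro equalityI subsetI)
    fix u assume "u \<in> v ` fibre A x"
    then obtain a where a: "a \<in> fibre A x" "u = v a" by blast
    then have "a \<in> {a \<in> pts (total A). proj A a \<in> U}" using U(2) by (simp add: fibre_def)
    then have "(proj A a, v a) \<in> (pts (base A) \<inter> U) \<times> {u. \<forall>i\<ge>vrank A. u i = 0}"
      using bij_betw_imp_surj_on[OF b] by blast
    then show "u \<in> {u. \<forall>i\<ge>vrank A. u i = 0}" using a(2) by (simp only: mem_Times_iff snd_conv)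
  next
    fix u assume "u \<in> {u. \<forall>i\<ge>vrank A. u i = (0::real)}"
    then have "(x, u) \<in> (\<lambda>a. (proj A a, v a)) ` {a \<in> pts (total A). proj A a \<in> U}"
      unfolding bij_betw_imp_surj_on[OF b] using U(2) assms(2) by simp
    then obtain a where a: "a \<in> {a \<in> pts (total A). proj A a \<in> U}" "(x, u) = (proj A a, v a)"
      by (rule imageE)
    then have "a \<in> fibre A x" "u = v a" by (simp_all add: fibre_def)
    then show "u \<in> v ` fibre A x" by (rule rev_image_eqI)
  qed
  ultimately have "bij_betw v (fibre A x) {u. \<forall>i\<ge>vrank A. u i = 0}"
    by (simp add: bij_betw_def)
  moreover have "fibre_linear A x (\<lambda>a. v a i)" for i
    using l[THEN bspec, OF U(2)] by (simp add: fibre_linear_def)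
  ultimately show thesis by (rule that)
qed

text \<open>The vectors \<open>e i\<close> are the preimages of the unit vectors and
  \<open>v\<close> gives coordinates. Stating the basis expansion under \<open>L\<close> avoids sums
  in the fibre.\<close>

lemma fibre_basis:
  assumes A: "vector_bundle A" "x \<in> pts (base A)"
  obtains e v where "\<And>i. i < vrank A \<Longrightarrow> e i \<in> fibre A x"
    and "\<And>L a. fibre_linear A x L \<Longrightarrow> a \<in> fibre A x \<Longrightarrow> L a = (\<Sum>i<vrank A. v a i * L (e i))"
proof -
  obtain v where b: "bij_betw v (fibre A x) {u. \<forall>i\<ge>vrank A. u i = (0::real)}"
    and v: "\<And>i. fibre_linear A x (\<lambda>a. v a i)"
    by (rule fibre_coordinates[OF A]) blast
  define e where "e k = inv_into (fibre A x) v (\<lambda>i. if i = k then 1 else 0)" for k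
  have im: "(\<lambda>i. if i = k then 1 else 0) \<in> v ` fibre A x" if "k < vrank A" for k
    using bij_betw_imp_surj_on[OF b] that by auto
  have e: "e k \<in> fibre A x" "v (e k) = (\<lambda>i. if i = k then 1 else 0)" if "k < vrank A" for k
    unfolding e_def using inv_into_into[OF im[OF that]] f_inv_into_f[OF im[OF that]] by auto
  \<comment> \<open>Induction on a bound \<open>k\<close> beyond which the coordinates vanish; the
    final use takes \<open>k = vrank A\<close>.\<close>
  have "L a = (\<Sum>i<k. v a i * L (e i))"
    if "fibre_linear A x L" "a \<in> fibre A x" "k \<le> vrank A" "\<forall>i\<ge>k. v a i = 0" for L a k
    using that(2-)
  proof (induction k arbitrary: a)
    case (0 a)
    have z: "vscale A 0 a \<in> fibre A x" using vscale_in_fibre[OF A 0(1)] .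
    \<comment> \<open>All coordinates of \<open>a\<close> vanish, so by injectivity \<open>a\<close>
      is its own zero multiple and every linear form kills it.\<close>
    have "v (vscale A 0 a) = v a"
      using fibre_linear_scale[OF v 0(1)] 0(3) by (simp add: fun_eq_iff)
    then have "vscale A 0 a = a"
      using bij_betw_imp_inj_on[OF b] z 0(1) by (auto dest: inj_onD)
    then have "L a = 0 * L a" using fibre_linear_scale[OF that(1) 0(1)] by metis
    then show ?case by simp
  next
    case (Suc k a)
    note a = Suc.prems(1)
    have k: "k < vrank A" using Suc.prems(2) by simp
    \<comment> \<open>Adding \<open>s\<close> clears the coordinate of index \<open>k\<close>, so
      the induction hypothesis applies to the sum.\<close>
    define s where "s = vscale A (- v a k) (e k)"
    have s: "s \<in> fibre A x" "v s = (\<lambda>i. if i = k then - v a k else 0)" "L s = - v a k * L (e k)"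
      unfolding s_def
      using fibre_linear_scale[OF v e(1)[OF k]] fibre_linear_scale[OF that(1) e(1)[OF k]]
        vscale_in_fibre[OF A e(1)[OF k]] by (auto simp: e(2)[OF k] fun_eq_iff)
    define a' where "a' = vadd A a s"
    have a': "a' \<in> fibre A x" "\<And>i. v a' i = v a i + v s i" "L a' = L a + L s"
      unfolding a'_def
      using vadd_in_fibre[OF A a s(1)] fibre_linear_add[OF v a s(1)] fibre_linear_add[OF that(1) a s(1)]
      by auto
    have "v a' i = 0" if "i \<ge> k" for i
      using Suc.prems(3) that by (cases "i = k") (auto simp: a'(2) s(2))
    then have "L a' = (\<Sum>i<k. v a' i * L (e i))"
      using Suc.IH[OF a'(1)] k by simp
    also have "\<dots> = (\<Sum>i<k. v a i * L (e i))"
      by (rule sum.cong) (auto simp: a'(2) s(2))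
    finally show ?case using a'(3) s(3) by simp
  qed
  then have "L a = (\<Sum>i<vrank A. v a i * L (e i))"
    if "fibre_linear A x L" "a \<in> fibre A x" for L a
    using that bij_betwE[OF b] by blast
  then show thesis using that e(1) by blast
qed

text \<open>Induction on \<open>I\<close>: if \<open>\<phi> j\<close> is nonzero somewhere on the
  common kernel of the other forms, a multiple of it is split off from \<open>L\<close>; otherwise
  it receives the coefficient 0.\<close>

lemma fibre_linear_in_span:
  assumes A: "vector_bundle A" "x \<in> pts (base A)"
    and "finite I" "\<And>i. i \<in> I \<Longrightarrow> fibre_linear A x (\<phi> i)" "fibre_linear A x L"
    and "\<And>u. u \<in> fibre A x \<Longrightarrow> \<forall>i\<in>I. \<phi> i u = 0 \<Longrightarrow> L u = 0"
  shows "\<exists>c. \<forall>u\<in>fibre A x. L u = (\<Sum>i\<in>I. c i * \<phi> i u)"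
  using assms(3-)
proof (induction I arbitrary: L rule: finite_induct)
  case (insert j I L)
  show ?case
  proof (cases "\<exists>w\<in>fibre A x. (\<forall>i\<in>I. \<phi> i w = 0) \<and> \<phi> j w \<noteq> 0")
    case True
    then obtain w where w: "w \<in> fibre A x" "\<forall>i\<in>I. \<phi> i w = 0" "\<phi> j w \<noteq> 0" by blast
    \<comment> \<open>The multiple of \<open>\<phi> j\<close> is chosen so that \<open>L'\<close>
      vanishes at \<open>w\<close>.\<close>
    define L' where "L' u = L u - L w / \<phi> j w * \<phi> j u" for u
    have lin: "fibre_linear A x L'"
      using insert.prems(1)[of j] insert.prems(2)
      by (simp add: fibre_linear_def L'_def algebra_simps)
    have "L' u = 0" if u: "u \<in> fibre A x" "\<forall>i\<in>I. \<phi> i u = 0" for u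
    proof -
      \<comment> \<open>Adding \<open>s\<close> moves \<open>u\<close> along \<open>w\<close> into
        the kernel of \<open>\<phi> j\<close> without leaving the common kernel of the forms indexed
        by \<open>I\<close>.\<close>
      define s where "s = vscale A (- \<phi> j u / \<phi> j w) w"
      have s: "s \<in> fibre A x" unfolding s_def using vscale_in_fibre[OF A w(1)] .
      have us: "K (vadd A u s) = K u - \<phi> j u / \<phi> j w * K w" if "fibre_linear A x K" for K
        using fibre_linear_add[OF that u(1) s] fibre_linear_scale[OF that w(1)]
        by (simp add: s_def)
      have "\<phi> i (vadd A u s) = 0" if "i \<in> insert j I" for i
        using us[OF insert.prems(1)[OF that]] that u(2) w by auto
      then have "L (vadd A u s) = 0"
        using insert.prems(3)[OF vadd_in_fibre[OF A u(1) s]] by blast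
      then show ?thesis using us[OF insert.prems(2)] by (simp add: L'_def field_simps)
    qed
    then obtain c where c: "\<forall>u\<in>fibre A x. L' u = (\<Sum>i\<in>I. c i * \<phi> i u)"
      using insert.IH[OF _ lin] insert.prems(1) by auto
    have "L u = (\<Sum>i\<in>insert j I. (c(j := L w / \<phi> j w)) i * \<phi> i u)" if "u \<in> fibre A x" for u
    proof -
      have "(\<Sum>i\<in>I. (c(j := L w / \<phi> j w)) i * \<phi> i u) = (\<Sum>i\<in>I. c i * \<phi> i u)"
        using insert.hyps by (intro sum.cong) auto
      then show ?thesis using insert.hyps c that by (auto simp: L'_def algebra_simps)
    qed
    then show ?thesis by blast
  next
    case False
    then have "L u = 0" if "u \<in> fibre A x" "\<forall>i\<in>I. \<phi> i u = 0" for u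
      using insert.prems(3) that by auto
    then obtain c where c: "\<forall>u\<in>fibre A x. L u = (\<Sum>i\<in>I. c i * \<phi> i u)"
      using insert.IH[OF _ insert.prems(2)] insert.prems(1) by auto
    have "L u = (\<Sum>i\<in>insert j I. (c(j := 0)) i * \<phi> i u)" if "u \<in> fibre A x" for u
    proof -
      have "(\<Sum>i\<in>I. (c(j := 0)) i * \<phi> i u) = (\<Sum>i\<in>I. c i * \<phi> i u)"
        using insert.hyps by (intro sum.cong) auto
      then show ?thesis using insert.hyps c that by auto
    qed
    then show ?thesis by blast
  qed
qed simp

lemma fibre_nonempty:
  assumes "vector_bundle A" "x \<in> pts (base A)"
  shows "fibre A x \<noteq> {}"
proof -
  obtain v where b: "bij_betw v (fibre A x) {u. \<forall>i\<ge>vrank A. u i = (0::real)}"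
    by (rule fibre_coordinates[OF assms]) blast
  have "(\<lambda>_. 0) \<in> {u. \<forall>i\<ge>vrank A. u i = (0::real)}" by simp
  then show ?thesis using bij_betw_imp_surj_on[OF b] by blast
qed

text \<open>Linear combinations in the fibre, recorded by their images under linear forms; the empty
  one is the zero multiple of any vector.\<close>

lemma fibre_combination:
  assumes A: "vector_bundle A" "x \<in> pts (base A)" and "finite I" "\<And>i. i \<in> I \<Longrightarrow> e i \<in> fibre A x"
  shows "\<exists>a\<in>fibre A x. \<forall>L. fibre_linear A x L \<longrightarrow> L a = (\<Sum>i\<in>I. c i * L (e i))"
  using assms(3,4)
proof (induction I rule: finite_induct)
  case empty
  obtain a where "a \<in> fibre A x" using fibre_nonempty[OF A] by blast
  then show ?case
    using vscale_in_fibre[OF A, of a 0] fibre_linear_scale[of A x _ a 0] by fastforce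
next
  case (insert j I)
  then obtain a where a: "a \<in> fibre A x"
    "\<forall>L. fibre_linear A x L \<longrightarrow> L a = (\<Sum>i\<in>I. c i * L (e i))" by auto
  have e: "e j \<in> fibre A x" using insert.prems by blast
  let ?s = "vscale A (c j) (e j)"
  have s: "?s \<in> fibre A x" using vscale_in_fibre[OF A e] .
  have "L (vadd A a ?s) = (\<Sum>i\<in>insert j I. c i * L (e i))" if "fibre_linear A x L" for L
    using a(2) that insert.hyps fibre_linear_add[OF that a(1) s] fibre_linear_scale[OF that e]
    by simp
  then show ?case using vadd_in_fibre[OF A a(1) s] by blast
qed

section \<open>Hamiltonian sections\<close>

lemma forms_add:
  assumes "\<omega> \<in> forms A k" "x \<in> pts (base A)" "as \<in> lists (fibre A x)" "length as = k" "i < k"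
    and "b \<in> fibre A x" "c \<in> fibre A x"
  shows "\<omega> x (as[i := vadd A b c]) = \<omega> x (as[i := b]) + \<omega> x (as[i := c])"
  using assms unfolding forms_def by simp

lemma forms_scale:
  assumes "\<omega> \<in> forms A k" "x \<in> pts (base A)" "as \<in> lists (fibre A x)" "length as = k" "i < k"
    and "b \<in> fibre A x"
  shows "\<omega> x (as[i := vscale A r b]) = r * \<omega> x (as[i := b])"
  using assms unfolding forms_def by simp

lemma forms_alternating:
  assumes "\<omega> \<in> forms A k" "x \<in> pts (base A)" "as \<in> lists (fibre A x)" "length as = k"
    and "i < j" "j < k" "as ! i = as ! j"
  shows "\<omega> x as = 0"
  using assms unfolding forms_def by blast

text \<open>In degree 0 only the anchor term of Cartan's formula remains: the double sum over
  \<open>i < j < 1\<close> is empty.\<close>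

lemma dA_function: "dA A (\<lambda>y _. k y) z [b] = anchor A b k"
  by (simp add: dA_def)

lemma symplectic_like_vector_bundle: "symplectic_like A \<Omega> \<Longrightarrow> vector_bundle A"
  by (simp add: symplectic_like_def lie_algebroid_def)

lemma symplectic_like_form: "symplectic_like A \<Omega> \<Longrightarrow> \<Omega> \<in> forms A 2"
  by (simp add: symplectic_like_def)

section \<open>Symplectic linear algebra in one fibre\<close>

context
  fixes A :: "('a, 'm) algebroid" and \<Omega> :: "('a, 'm) form" and x :: 'm
  assumes sympl: "symplectic_like A \<Omega>" and x: "x \<in> pts (base A)"
begin

lemma symplectic_like_linear1:
  assumes "b \<in> fibre A x"
  shows "fibre_linear A x (\<lambda>a. \<Omega> x [a, b])"
  \<comment> \<open>The list \<open>[b, b]\<close> is a template: updating entry 0 leaves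
    \<open>b\<close> as the fixed second argument.\<close>
  using forms_add[OF symplectic_like_form[OF sympl] x, of "[b, b]" 0] assms
    forms_scale[OF symplectic_like_form[OF sympl] x, of "[b, b]" 0]
  by (simp add: fibre_linear_def)

lemma symplectic_like_linear2:
  assumes "b \<in> fibre A x"
  shows "fibre_linear A x (\<lambda>a. \<Omega> x [b, a])"
  using forms_add[OF symplectic_like_form[OF sympl] x, of "[b, b]" 1] assms
    forms_scale[OF symplectic_like_form[OF sympl] x, of "[b, b]" 1]
  by (simp add: fibre_linear_def)

lemma symplectic_like_alternating:
  assumes "a \<in> fibre A x"
  shows "\<Omega> x [a, a] = 0"
  using forms_alternating[OF symplectic_like_form[OF sympl] x, of "[a, a]" 0 1] assms by simp

text \<open>Polarization: the value of \<open>\<Omega> x\<close> on \<open>vadd A a b\<close> taken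
  twice is 0 and expands into four terms.\<close>

lemma symplectic_like_skew:
  assumes a: "a \<in> fibre A x" and b: "b \<in> fibre A x"
  shows "\<Omega> x [a, b] = - \<Omega> x [b, a]"
proof -
  have ab: "vadd A a b \<in> fibre A x"
    using vadd_in_fibre[OF symplectic_like_vector_bundle[OF sympl] x a b] .
  have "0 = \<Omega> x [vadd A a b, vadd A a b]" using symplectic_like_alternating[OF ab] by simp
  also have "\<dots> = \<Omega> x [a, a] + \<Omega> x [a, b] + (\<Omega> x [b, a] + \<Omega> x [b, b])"
    using fibre_linear_add[OF symplectic_like_linear1[OF ab] a b]
      fibre_linear_add[OF symplectic_like_linear2[OF a] a b]
      fibre_linear_add[OF symplectic_like_linear2[OF b] a b] by simp
  finally show ?thesis
    using symplectic_like_alternating[OF a] symplectic_like_alternating[OF b] by simp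
qed

lemma symplectic_like_kernel:
  assumes "a \<in> fibre A x" "\<And>b. b \<in> fibre A x \<Longrightarrow> \<Omega> x [a, b] = 0"
  shows "a = vscale A 0 a"
  using sympl x assms unfolding symplectic_like_def by blast

text \<open>Nondegeneracy makes the difference \<open>d\<close> its own zero multiple; its
  coordinates are then 0, so \<open>a\<close> and \<open>a'\<close> have equal coordinates.\<close>

lemma symplectic_like_inj:
  assumes a: "a \<in> fibre A x" and a': "a' \<in> fibre A x"
    and eq: "\<And>b. b \<in> fibre A x \<Longrightarrow> \<Omega> x [a, b] = \<Omega> x [a', b]"
  shows "a = a'"
proof -
  note vb = symplectic_like_vector_bundle[OF sympl]
  obtain v where b: "bij_betw v (fibre A x) {u. \<forall>i\<ge>vrank A. u i = (0::real)}"
    and v: "\<And>i. fibre_linear A x (\<lambda>a. v a i)"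
    by (rule fibre_coordinates[OF vb x]) blast
  define n d where "n = vscale A (-1) a'" and "d = vadd A a n"
  have n: "n \<in> fibre A x" and d: "d \<in> fibre A x"
    unfolding d_def n_def using vscale_in_fibre[OF vb x a'] vadd_in_fibre[OF vb x a] by blast+
  have L: "L d = L a - L a'" if "fibre_linear A x L" for L
    using fibre_linear_add[OF that a n] fibre_linear_scale[OF that a', of "-1"]
    by (simp add: d_def n_def)
  have "\<Omega> x [d, c] = 0" if "c \<in> fibre A x" for c
    using L[OF symplectic_like_linear1[OF that]] eq[OF that] by simp
  then have "d = vscale A 0 d" using symplectic_like_kernel[OF d] by blast
  then have "v d i = 0 * v d i" for i using fibre_linear_scale[OF v d] by metis
  then have "v a = v a'" using L[OF v] by (simp add: fun_eq_iff)
  then show ?thesis using bij_betw_imp_inj_on[OF b] a a' by (auto dest: inj_onD)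
qed

text \<open>By nondegeneracy the forms pairing \<open>e i\<close> with a vector vanish together only
  at zero, so \<open>L\<close> lies in their span; the same coefficients on the \<open>e i\<close>
  give the vector \<open>a\<close>.\<close>

lemma symplectic_like_surj:
  assumes L: "fibre_linear A x L"
  shows "\<exists>a\<in>fibre A x. \<forall>b\<in>fibre A x. \<Omega> x [a, b] = L b"
proof -
  note vb = symplectic_like_vector_bundle[OF sympl]
  obtain e v where e: "\<And>i. i < vrank A \<Longrightarrow> e i \<in> fibre A x"
    and ev: "\<And>L a. fibre_linear A x L \<Longrightarrow> a \<in> fibre A x \<Longrightarrow> L a = (\<Sum>i<vrank A. v a i * L (e i))"
    by (rule fibre_basis[OF vb x]) blast
  have "L u = 0" if u: "u \<in> fibre A x" and 0: "\<forall>i\<in>{..<vrank A}. \<Omega> x [e i, u] = 0" for u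
  proof -
    \<comment> \<open>Expanding \<open>b\<close> in the basis and using skew-symmetry reduces this
      to the assumed zeros.\<close>
    have "\<Omega> x [u, b] = 0" if "b \<in> fibre A x" for b
      using ev[OF symplectic_like_linear1[OF u] that] 0 symplectic_like_skew[OF u that] by simp
    then have "u = vscale A 0 u" using symplectic_like_kernel[OF u] by blast
    then have "L u = 0 * L u" using fibre_linear_scale[OF L u] by metis
    then show ?thesis by simp
  qed
  then obtain c where c: "\<forall>u\<in>fibre A x. L u = (\<Sum>i<vrank A. c i * \<Omega> x [e i, u])"
    using fibre_linear_in_span[OF vb x, of "{..<vrank A}" "\<lambda>i u. \<Omega> x [e i, u]" L]
      symplectic_like_linear2 e L by auto
  obtain a where "a \<in> fibre A x"
    "\<forall>L. fibre_linear A x L \<longrightarrow> L a = (\<Sum>i<vrank A. c i * L (e i))"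
    using fibre_combination[OF vb x, of "{..<vrank A}" e c] e by auto
  then show ?thesis using c symplectic_like_linear1 by fastforce
qed

lemma ham_section_eqI:
  assumes "a \<in> fibre A x" "\<And>b. b \<in> fibre A x \<Longrightarrow> \<Omega> x [a, b] = anchor A b k"
  shows "ham_section A \<Omega> k x = a"
  unfolding ham_section_def using x assms
  by (auto simp: dA_function intro!: the_equality intro: symplectic_like_inj)

lemma anchor_linear: "fibre_linear A x (\<lambda>b. anchor A b k)"
  using sympl x by (auto simp: symplectic_like_def lie_algebroid_def fibre_linear_def)

text \<open>The element described in \<open>ham_section\<close> exists by
  \<open>symplectic_like_surj\<close>, applied to the linear form
  \<open>b \<mapsto> anchor A b k\<close>.\<close>

lemma ham_section_spec:
  shows "ham_section A \<Omega> k x \<in> fibre A x"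
    and "\<And>b. b \<in> fibre A x \<Longrightarrow> \<Omega> x [ham_section A \<Omega> k x, b] = anchor A b k"
proof -
  obtain a where a: "a \<in> fibre A x" "\<forall>b\<in>fibre A x. \<Omega> x [a, b] = anchor A b k"
    using symplectic_like_surj[OF anchor_linear] by blast
  then have "ham_section A \<Omega> k x = a" by (intro ham_section_eqI) auto
  then show "ham_section A \<Omega> k x \<in> fibre A x"
    and "\<And>b. b \<in> fibre A x \<Longrightarrow> \<Omega> x [ham_section A \<Omega> k x, b] = anchor A b k"
    using a by auto
qed

end

text \<open>A smooth function is a form of degree 0, and commutation with the differentials in that
  degree is compatibility of the anchors.\<close>

lemma lie_algebroid_morphism_anchor:
  assumes "lie_algebroid_morphism A A' F f" "k \<in> Cinf (base A')" "x \<in> pts (base A)" "a \<in> fibre A x"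
  shows "anchor A a (k \<circ> f) = anchor A' (F a) k"
proof -
  have "(\<lambda>y _. k y) \<in> forms A' 0" using assms(2) by (simp add: forms_def)
  then have "form_eq A 1 (dA A (pullback F f (\<lambda>y _. k y))) (pullback F f (dA A' (\<lambda>y _. k y)))"
    using assms(1) unfolding lie_algebroid_morphism_def One_nat_def by blast
  then have "dA A (pullback F f (\<lambda>y _. k y)) x [a] = pullback F f (dA A' (\<lambda>y _. k y)) x [a]"
    using assms(3,4) by (simp add: form_eq_def)
  then show ?thesis by (simp add: dA_def pullback_def comp_def)
qed

text \<open>Tangency at \<open>x\<close> is part of the smoothness of
  \<open>a \<mapsto> (proj A a, anchor A a)\<close>, whose values must be points of the tangent
  bundle.\<close>

lemma anchor_in_tangent_space:
  assumes "lie_algebroid A" "a \<in> fibre A x"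
  shows "anchor A a \<in> tangent_space (base A) x"
proof -
  have "(x, anchor A a) \<in> pts (tangent_bundle (base A))"
    using assms by (auto simp: lie_algebroid_def smooth_map_def fibre_def)
  then show ?thesis by (auto simp: pts_def tangent_bundle_def)
qed

text \<open>
  The generator of the action on the total space is projectable, so \<open>\<rho>(\<psi>(\<xi>))\<close> differentiates a
  function along the orbits in the base.
\<close>

lemma anchor_generator_invariant:
  assumes act: "action_by_complete_lifts G A \<Phi> \<phi> \<psi>" and G: "is_lie_group G"
    and A: "vector_bundle A" and \<xi>: "\<xi> \<in> lie_alg G" and x: "x \<in> pts (base A)"
    and inv: "\<And>h. h \<in> carrier G \<Longrightarrow> k (\<phi> h x) = k x"
  shows "anchor A (\<psi> \<xi> x) k = 0"
proof -
  obtain a where a: "a \<in> pts (total A)" "proj A a = x"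
    using fibre_nonempty[OF A x] by (auto simp: fibre_def)
  have "proj A (\<Phi> h a) = \<phi> h x" if "h \<in> carrier G" for h
    using act that a by (auto simp: action_by_complete_lifts_def vb_morphism_def)
  \<comment> \<open>On \<open>carrier G\<close>, the set of points of \<open>gmfd G\<close>, this
    composite is constantly \<open>k x\<close>.\<close>
  then have "\<xi> (k \<circ> proj A \<circ> (\<lambda>h. \<Phi> h a)) = 0"
    using G \<xi> inv
    by (intro tangent_vector_const[of "gmfd G" \<xi> "\<one>\<^bsub>G\<^esub>" _ "k x"]) (auto simp: is_lie_group_def lie_alg_def)
  moreover have "anchor A (\<psi> \<xi> x) =
      tangent_map (total A) (base A) (proj A) a (inf_generator G (total A) \<Phi> \<xi> a)"
    using act \<xi> a by (auto simp: action_by_complete_lifts_def complete_lift_def)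
  \<comment> \<open>Both tangent maps unfold to conditionals on smoothness, and every branch has the
    value 0.\<close>
  ultimately show ?thesis
    by (simp add: tangent_map_def inf_generator_def)
qed

section \<open>Comparison of the two Poisson brackets\<close>

theorem theorem3p13:
  fixes G :: "'g lie_group"
    and A :: "('a, 'm) algebroid"
    and \<Omega> :: "('a, 'm) form"
    and \<Phi> :: "'g \<Rightarrow> 'a \<Rightarrow> 'a"
    and \<phi> :: "'g \<Rightarrow> 'm \<Rightarrow> 'm"
    and \<psi> :: "'g tvec \<Rightarrow> 'm \<Rightarrow> 'a"
    and J :: "'m \<Rightarrow> 'g tvec \<Rightarrow> real"
    and \<mu> :: "'g tvec \<Rightarrow> real"
    and B :: "('a, 'm) algebroid"
    and A\<^sub>\<mu> :: "('a set, 'm set) algebroid"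
    and \<Omega>\<^sub>\<mu> :: "('a set, 'm set) form"
    and f\<^sub>\<mu> g\<^sub>\<mu> :: "'m set \<Rightarrow> real"
    and f g :: "'m \<Rightarrow> real"
  assumes "symplectic_like A \<Omega>"
    and "is_lie_group G"
    and "connected_space (mtop (gmfd G))"
    and "hamiltonian_action G A \<Omega> \<Phi> \<phi> \<psi> J"
    and "regular_value G (base A) J \<mu>"
    and "constant_rank_on_level G A J \<mu>"
    and "free_action_on G (isotropy G \<mu>) (level_set (base A) J \<mu>) \<phi>"
    and "proper_action_on G (isotropy G \<mu>) (base A) (level_set (base A) J \<mu>) \<phi>"
    and "reduced_algebroid G A \<Omega> \<Phi> \<phi> \<psi> J \<mu> B A\<^sub>\<mu> \<Omega>\<^sub>\<mu>"
    and "f\<^sub>\<mu> \<in> Cinf (base A\<^sub>\<mu>)" and "g\<^sub>\<mu> \<in> Cinf (base A\<^sub>\<mu>)"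
    and "f \<in> Cinf (base A)" and "g \<in> Cinf (base A)"
    and "\<forall>h\<in>carrier G. \<forall>x\<in>pts (base A). f (\<phi> h x) = f x"
    and "\<forall>h\<in>carrier G. \<forall>x\<in>pts (base A). g (\<phi> h x) = g x"
    and "\<forall>x\<in>level_set (base A) J \<mu>. f x = f\<^sub>\<mu> (base_orbit G \<mu> \<phi> x)"
    and "\<forall>x\<in>level_set (base A) J \<mu>. g x = g\<^sub>\<mu> (base_orbit G \<mu> \<phi> x)"
  shows "\<forall>x\<in>level_set (base A) J \<mu>.
    poisson A\<^sub>\<mu> \<Omega>\<^sub>\<mu> f\<^sub>\<mu> g\<^sub>\<mu> (base_orbit G \<mu> \<phi> x) = poisson A \<Omega> f g x"
proof
  fix x assume x: "x \<in> level_set (base A) J \<mu>"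
  note sA = assms(1)
  have xA: "x \<in> pts (base A)" and Jx: "J x = \<mu>" using x by (auto simp: level_set_def)
  have vbA: "vector_bundle A" by (rule symplectic_like_vector_bundle[OF sA])
  have act: "action_by_complete_lifts G A \<Phi> \<phi> \<psi>"
    and mom: "\<And>\<xi>. \<xi> \<in> lie_alg G \<Longrightarrow> form_eq A 1 (interior (\<psi> \<xi>) \<Omega>) (dA A (\<lambda>x _. J x \<xi>))"
    using assms(4) by (auto simp: hamiltonian_action_def)
  let ?\<pi> = "base_orbit G \<mu> \<phi>" and ?F = "total_orbit G A \<mu> \<Phi> \<psi>"
  have BA: "lie_subalgebroid A B"
    and totB: "pts (total B) = {a \<in> pts (total A). JT G A J a = ((\<lambda>_. 0), \<mu>)}"
    and baseB: "pts (base B) = level_set (base A) J \<mu>"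
    and sC: "symplectic_like A\<^sub>\<mu> \<Omega>\<^sub>\<mu>"
    and epi: "lie_algebroid_epimorphism B A\<^sub>\<mu> ?F ?\<pi>"
    and pb: "form_eq B 2 (pullback ?F ?\<pi> \<Omega>\<^sub>\<mu>) (pullback (\<lambda>a. a) (\<lambda>x. x) \<Omega>)"
    using assms(9) by (auto simp: reduced_algebroid_def)
  have xB: "x \<in> pts (base B)" using x baseB by simp
  have lB: "lie_algebroid B" and morA: "lie_algebroid_morphism B A (\<lambda>a. a) (\<lambda>x. x)"
    using BA by (auto simp: lie_subalgebroid_def)
  have mfB: "smooth_manifold (base B)"
    using lB by (simp add: lie_algebroid_def vector_bundle_def)
  have morC: "lie_algebroid_morphism B A\<^sub>\<mu> ?F ?\<pi>"
    and xC: "?\<pi> x \<in> pts (base A\<^sub>\<mu>)" and fib: "?F ` fibre B x = fibre A\<^sub>\<mu> (?\<pi> x)"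
    using epi xB by (auto simp: lie_algebroid_epimorphism_def)
  have projB: "proj A a = proj B a" if "a \<in> pts (total B)" for a
    using morA that by (simp add: lie_algebroid_morphism_def vb_morphism_def)
  have fibB: "fibre B x = {a \<in> fibre A x. a \<in> pts (total B)}"
    using projB totB by (auto simp: fibre_def)
  \<comment> \<open>Both anchors are compared inside \<open>B\<close>, the common domain of the
    inclusion into \<open>A\<close> and the projection onto \<open>A\<^sub>\<mu>\<close>. This
    serves for \<open>g\<close> on all of the fibre and for \<open>f\<close> at
    \<open>h\<close>.\<close>
  have reduce: "anchor A\<^sub>\<mu> (?F a) k\<^sub>\<mu> = anchor A a k"
    if a: "a \<in> fibre B x" and k: "k \<in> Cinf (base A)" "k\<^sub>\<mu> \<in> Cinf (base A\<^sub>\<mu>)"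
      "\<forall>y\<in>level_set (base A) J \<mu>. k y = k\<^sub>\<mu> (?\<pi> y)" for a k k\<^sub>\<mu>
  proof -
    have "anchor A\<^sub>\<mu> (?F a) k\<^sub>\<mu> = anchor B a (k\<^sub>\<mu> \<circ> ?\<pi>)"
      using lie_algebroid_morphism_anchor[OF morC k(2) xB a] by simp
    \<comment> \<open>The two functions agree on \<open>pts (base B)\<close>, which is enough for a
      tangent vector of \<open>base B\<close>.\<close>
    also have "\<dots> = anchor B a (k \<circ> (\<lambda>x. x))"
      using k(3) baseB by (intro tangent_vector_cong[OF mfB anchor_in_tangent_space[OF lB a]]) simp
    also have "\<dots> = anchor A a k"
      by (rule lie_algebroid_morphism_anchor[OF morA k(1) xB a])
    finally show ?thesis .
  qed
  define h where "h = ham_section A \<Omega> g x"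
  have h: "h \<in> fibre A x" "\<And>b. b \<in> fibre A x \<Longrightarrow> \<Omega> x [h, b] = anchor A b g"
    unfolding h_def using ham_section_spec[OF sA xA] by blast+
  have "anchor A h (\<lambda>y. J y \<xi>) = 0" if \<xi>: "\<xi> \<in> lie_alg G" for \<xi>
  proof -
    have sec: "\<psi> \<xi> \<in> sections A"
      using act \<xi> by (auto simp: action_by_complete_lifts_def lie_alg_antimorphism_def)
    have p: "\<psi> \<xi> x \<in> fibre A x"
      using sec xA by (auto simp: sections_def smooth_map_def fibre_def)
    have "interior (\<psi> \<xi>) \<Omega> x [h] = dA A (\<lambda>x _. J x \<xi>) x [h]"
      using mom[OF \<xi>] xA h(1) by (simp add: form_eq_def)
    then have "anchor A h (\<lambda>y. J y \<xi>) = \<Omega> x [\<psi> \<xi> x, h]"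
      by (simp add: interior_def dA_def)
    also have "\<dots> = - anchor A (\<psi> \<xi> x) g"
      using symplectic_like_skew[OF sA xA p h(1)] h(2)[OF p] by simp
    also have "\<dots> = 0"
      using anchor_generator_invariant[OF act assms(2) vbA \<xi> xA, of g] assms(15) xA by simp
    finally show ?thesis .
  qed
  \<comment> \<open>\<open>TJ\<close> is 0 outside \<open>lie_alg G\<close> by definition, so
    vanishing on \<open>lie_alg G\<close> makes it the zero functional.\<close>
  then have "h \<in> pts (total B)"
    using h(1) Jx by (auto simp: totB JT_def TJ_def fibre_def)
  then have hB: "h \<in> fibre B x" using h(1) fibB by simp
  have "ham_section A\<^sub>\<mu> \<Omega>\<^sub>\<mu> g\<^sub>\<mu> (?\<pi> x) = ?F h"
  proof (rule ham_section_eqI[OF sC xC])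
    show "?F h \<in> fibre A\<^sub>\<mu> (?\<pi> x)" using hB fib by blast
    \<comment> \<open>Since \<open>?F\<close> is onto the fibre, the defining equation need only be
      tested on images of vectors \<open>b\<close> of \<open>B\<close>.\<close>
    fix c assume "c \<in> fibre A\<^sub>\<mu> (?\<pi> x)"
    then obtain b where b: "b \<in> fibre B x" "c = ?F b" using fib by blast
    have "pullback ?F ?\<pi> \<Omega>\<^sub>\<mu> x [h, b] = pullback (\<lambda>a. a) (\<lambda>x. x) \<Omega> x [h, b]"
      using pb xB hB b(1) by (simp add: form_eq_def)
    then have "\<Omega>\<^sub>\<mu> (?\<pi> x) [?F h, c] = \<Omega> x [h, b]"
      by (simp add: pullback_def b(2))
    also have "\<dots> = anchor A b g" using h(2) b(1) fibB by blast
    also have "\<dots> = anchor A\<^sub>\<mu> c g\<^sub>\<mu>"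
      using reduce[OF b(1) assms(13,11,17)] b(2) by simp
    finally show "\<Omega>\<^sub>\<mu> (?\<pi> x) [?F h, c] = anchor A\<^sub>\<mu> c g\<^sub>\<mu>" .
  qed
  then show "poisson A\<^sub>\<mu> \<Omega>\<^sub>\<mu> f\<^sub>\<mu> g\<^sub>\<mu> (?\<pi> x) = poisson A \<Omega> f g x"
    using reduce[OF hB assms(12,10,16)] by (simp add: poisson_def h_def)
qed

end
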